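(* Let $M$ be the closed 3-disk. For every $N>0$ and every $c\in(0,1)$ there exists a Riemannian metric $g'=g'(c,N)$ on $M$ such that the diameter $d$ of $(M,g')$, the volume $V$ of $(M,g')$ and the surface area $A$ of $\partial M$ with respect to $g'$ are all bounded above by $10$, but any smooth embedded disk $D$ with $\partial D\subset\partial M$ that subdivides $M$ into two regions, each of volume greater than $cV$, has area greater than $N$.
   Context: A disk $D$ subdividing $M$ is the image of a smooth embedding of pairs $f:(D^2,\partial D^2)\to(M,\partial M)$ of the closed 2-disk; the two regions are the two components into which $D$ separates $M$. Volumes and areas are Riemannian volumes and areas with respect to $g'$. *)

theory Defs
  imports "HOL-Analysis.Analysis"
begin

subsection \<open>Smooth maps\<close>

text \<open>Only used with an open set \<^term>\<open>U\<close>.\<close>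

primrec Ck_on :: "nat \<Rightarrow> ('a::euclidean_space \<Rightarrow> 'b::real_normed_vector) \<Rightarrow> 'a set \<Rightarrow> bool" where
  "Ck_on 0 f U \<longleftrightarrow> continuous_on U f"
| "Ck_on (Suc k) f U \<longleftrightarrow>
     (\<forall>x\<in>U. f differentiable (at x)) \<and>
     (\<forall>v. Ck_on k (\<lambda>x. frechet_derivative f (at x) v) U)"

text \<open>Smoothness on an arbitrary (here: compact) set means the existence of a smooth extension
  to an open neighbourhood.\<close>

definition smooth_on :: "'a::euclidean_space set \<Rightarrow> ('a \<Rightarrow> 'b::real_normed_vector) \<Rightarrow> bool" where
  "smooth_on A f \<longleftrightarrow>
     (\<exists>U F. open U \<and> A \<subseteq> U \<and> (\<forall>k. Ck_on k F U) \<and> (\<forall>x\<in>A. F x = f x))"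

subsection \<open>Riemannian metrics on the closed 3-disk\<close>

abbreviation D2 :: "(real^2) set" where "D2 \<equiv> cball 0 1"
abbreviation bdD2 :: "(real^2) set" where "bdD2 \<equiv> sphere 0 1"
abbreviation M3 :: "(real^3) set" where "M3 \<equiv> cball 0 1"
abbreviation bdM3 :: "(real^3) set" where "bdM3 \<equiv> sphere 0 1"

text \<open>A metric is given by its coefficient matrix in the standard coordinates of the ambient
  space, so that the inner product of tangent vectors \<open>v\<close>, \<open>w\<close> at \<open>x\<close> is \<open>v \<bullet> (g x *v w)\<close>.\<close>

definition riemannian_metric :: "(real^3 \<Rightarrow> real^3^3) \<Rightarrow> bool" where
  "riemannian_metric g \<longleftrightarrow>
     smooth_on M3 g \<and>
     (\<forall>x\<in>M3. transpose (g x) = g x \<and> (\<forall>v. v \<noteq> 0 \<longrightarrow> v \<bullet> (g x *v v) > 0))"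

text \<open>Lengths, volumes and areas take values in \<^typ>\<open>ennreal\<close>, so that none of the suprema,
  infima and integrals below needs a side condition.\<close>

definition curve_length :: "(real^3 \<Rightarrow> real^3^3) \<Rightarrow> (real \<Rightarrow> real^3) \<Rightarrow> ennreal" where
  "curve_length g \<gamma> =
     (\<integral>\<^sup>+t\<in>{0..1}. ennreal (sqrt (vector_derivative \<gamma> (at t) \<bullet>
        (g (\<gamma> t) *v vector_derivative \<gamma> (at t)))) \<partial>lborel)"

definition riemannian_dist :: "(real^3 \<Rightarrow> real^3^3) \<Rightarrow> real^3 \<Rightarrow> real^3 \<Rightarrow> ennreal" where
  "riemannian_dist g p q =
     (INF \<gamma>\<in>{\<gamma>. \<gamma> piecewise_C1_differentiable_on {0..1} \<and> path_image \<gamma> \<subseteq> M3 \<and>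
                pathstart \<gamma> = p \<and> pathfinish \<gamma> = q}. curve_length g \<gamma>)"

definition riemannian_diameter :: "(real^3 \<Rightarrow> real^3^3) \<Rightarrow> ennreal" where
  "riemannian_diameter g = (SUP p\<in>M3. SUP q\<in>M3. riemannian_dist g p q)"

definition riemannian_volume :: "(real^3 \<Rightarrow> real^3^3) \<Rightarrow> (real^3) set \<Rightarrow> ennreal" where
  "riemannian_volume g R = (\<integral>\<^sup>+x\<in>R. ennreal (sqrt (det (g x))) \<partial>lborel)"

text \<open>The matrix of the pulled-back metric \<open>f\<^sup>* g\<close> at \<open>u\<close>. The derivative is taken within the domain
  \<open>A\<close> of \<open>f\<close>; it is unique for the domains used here, the closed disk and the plane.\<close>

definition pullback_metric ::
    "(real^3 \<Rightarrow> real^3^3) \<Rightarrow> (real^2 \<Rightarrow> real^3) \<Rightarrow> (real^2) set \<Rightarrow> real^2 \<Rightarrow> real^2^2" where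
  "pullback_metric g f A u =
     (let J = matrix (frechet_derivative f (at u within A))
      in transpose J ** g (f u) ** J)"

text \<open>For an injective immersion \<open>f\<close> this is the Riemannian area of the surface \<open>f ` A\<close>, independently
  of the parametrization.\<close>

definition surface_area ::
    "(real^3 \<Rightarrow> real^3^3) \<Rightarrow> (real^2 \<Rightarrow> real^3) \<Rightarrow> (real^2) set \<Rightarrow> ennreal" where
  "surface_area g f A = (\<integral>\<^sup>+u\<in>A. ennreal (sqrt (det (pullback_metric g f A u))) \<partial>lborel)"

text \<open>Inverse stereographic projection parametrizes the boundary sphere up to one point, which
  has area zero.\<close>

definition stereo :: "real^2 \<Rightarrow> real^3" where
  "stereo u = (1 / (1 + (norm u)\<^sup>2)) *\<^sub>R vector [2 * u$1, 2 * u$2, (norm u)\<^sup>2 - 1]"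

lemma norm_sq_2: "(norm (u::real^2))\<^sup>2 = (u$1)\<^sup>2 + (u$2)\<^sup>2"
  unfolding power2_norm_eq_inner inner_vec_def by (simp add: sum_2 power2_eq_square)

lemma norm_sq_3: "(norm (x::real^3))\<^sup>2 = (x$1)\<^sup>2 + (x$2)\<^sup>2 + (x$3)\<^sup>2"
  unfolding power2_norm_eq_inner inner_vec_def by (simp add: sum_3 power2_eq_square)

lemma bij_betw_stereo: "bij_betw stereo UNIV (bdM3 - {axis 3 1})"
proof (rule bij_betw_byWitness[where f' = "\<lambda>x. vector [x$1 / (1 - x$3), x$2 / (1 - x$3)]"])
  have pos: "1 + (norm u)\<^sup>2 \<noteq> 0" for u :: "real^2"
    using zero_le_power2[of "norm u"] by linarith
  have c3: "1 - stereo u $ 3 = 2 / (1 + (norm u)\<^sup>2)" for u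
    using pos[of u] by (simp add: stereo_def vector_3 field_simps)
  show "\<forall>u\<in>UNIV. vector [stereo u $ 1 / (1 - stereo u $ 3), stereo u $ 2 / (1 - stereo u $ 3)] = u"
    unfolding c3 using pos by (simp add: vec_eq_iff forall_2 vector_2 stereo_def vector_3)
  show "\<forall>x\<in>bdM3 - {axis 3 1}. stereo (vector [x$1 / (1 - x$3), x$2 / (1 - x$3)]) = x"
  proof
    fix x :: "real^3" assume x: "x \<in> bdM3 - {axis 3 1}"
    then have n: "(x$1)\<^sup>2 + (x$2)\<^sup>2 + (x$3)\<^sup>2 = 1"
      using norm_sq_3[of x] by simp
    have ne: "1 - x$3 \<noteq> 0"
    proof
      assume "1 - x$3 = 0"
      then have "x$3 = 1" by simp
      with n have "x$1 = 0" "x$2 = 0" by (simp_all add: sum_power2_eq_zero_iff)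
      with \<open>x$3 = 1\<close> have "x = axis 3 1" by (simp add: vec_eq_iff forall_3 axis_def)
      with x show False by simp
    qed
    let ?u = "vector [x$1 / (1 - x$3), x$2 / (1 - x$3)] :: real^2"
    have "(norm ?u)\<^sup>2 = ((x$1)\<^sup>2 + (x$2)\<^sup>2) / (1 - x$3)\<^sup>2"
      by (simp add: norm_sq_2 vector_2 power_divide add_divide_distrib)
    also have "(x$1)\<^sup>2 + (x$2)\<^sup>2 = (1 + x$3) * (1 - x$3)"
      using n by (simp add: algebra_simps power2_eq_square)
    finally have nu: "(norm ?u)\<^sup>2 = (1 + x$3) / (1 - x$3)"
      using ne by (simp add: power2_eq_square)
    have q: "1 + (norm ?u)\<^sup>2 = 2 / (1 - x$3)" "(norm ?u)\<^sup>2 - 1 = 2 * x$3 / (1 - x$3)"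
      using ne unfolding nu by (simp_all add: field_simps)
    show "stereo ?u = x"
      unfolding stereo_def q using ne by (simp add: vec_eq_iff forall_3 vector_3 vector_2)
  qed
  show "stereo ` UNIV \<subseteq> bdM3 - {axis 3 1}"
  proof safe
    fix u
    have "(norm (stereo u))\<^sup>2 = (4 * (norm u)\<^sup>2 + ((norm u)\<^sup>2 - 1)\<^sup>2) / (1 + (norm u)\<^sup>2)\<^sup>2"
      unfolding norm_sq_3 by (simp add: stereo_def vector_3 power_divide power_mult_distrib
          add_divide_distrib norm_sq_2 distrib_left)
    also have "4 * (norm u)\<^sup>2 + ((norm u)\<^sup>2 - 1)\<^sup>2 = (1 + (norm u)\<^sup>2)\<^sup>2"
      by (simp add: power2_eq_square algebra_simps)
    finally have "(norm (stereo u))\<^sup>2 = 1" using pos[of u] by simp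
    then show "stereo u \<in> bdM3" by (simp add: power2_eq_1_iff) (use norm_ge_zero[of "stereo u"] in linarith)
    assume "stereo u = axis 3 1"
    then show False using c3[of u] pos[of u] by (simp add: axis_def)
  qed
qed simp_all

definition boundary_area :: "(real^3 \<Rightarrow> real^3^3) \<Rightarrow> ennreal" where
  "boundary_area g = surface_area g stereo UNIV"

subsection \<open>Subdividing disks\<close>

text \<open>A smooth embedding of pairs \<open>(D2, bdD2) \<rightarrow> (M3, bdM3)\<close>; an injective immersion of a compact
  space is an embedding.\<close>

definition smooth_disk_embedding :: "(real^2 \<Rightarrow> real^3) \<Rightarrow> bool" where
  "smooth_disk_embedding f \<longleftrightarrow>
     smooth_on D2 f \<and> inj_on f D2 \<and>
     (\<forall>u\<in>D2. inj (frechet_derivative f (at u within D2))) \<and>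
     f ` D2 \<subseteq> M3 \<and> f ` bdD2 \<subseteq> bdM3"

definition subdivides_into :: "(real^3) set \<Rightarrow> (real^3) set \<Rightarrow> (real^3) set \<Rightarrow> bool" where
  "subdivides_into D R\<^sub>1 R\<^sub>2 \<longleftrightarrow> R\<^sub>1 \<noteq> R\<^sub>2 \<and> components (M3 - D) = {R\<^sub>1, R\<^sub>2}"

end

theory Submission
  imports Defs
begin

text \<open>The metric is a large multiple of a sub-Riemannian one. Put
  \<open>G = dx\<^sup>2 + dy\<^sup>2 + T\<^sup>6 (dz - x dy)\<^sup>2\<close> and \<open>g = (w / T)\<^sup>2 G\<close>. The volume density of \<open>g\<close> is \<open>w\<^sup>3\<close>,
  whatever \<open>T\<close> is, but the area of a surface is at least \<open>T w\<^sup>2\<close> times the area of its projection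
  along each of the horizontal fields \<open>X = \<partial>\<^sub>x\<close> and \<open>Y = \<partial>\<^sub>y + x \<partial>\<^sub>z\<close>. So a disk of area at most \<open>N\<close> meets,
  for \<open>T\<close> large, only a small set of \<open>X\<close>-lines and of \<open>Y\<close>-lines. The other lines do not leave a
  region of the complement of the disk. Since \<open>X\<close>, \<open>Y\<close> and \<open>[X, Y] = \<partial>\<^sub>z\<close> span all directions, enough
  pairs of points are joined by three such lines to force one of the two regions to have small
  volume.

  The weight \<open>w = \<epsilon> + (1 - r\<^sup>2)\<^sup>m\<close> concentrates the volume near the centre, where these lines
  stay in the ball, and makes the boundary sphere tiny for small \<open>\<epsilon>\<close>. The diameter is small because
  \<open>X\<close>-lines are short and lead to the boundary.\<close>

section \<open>Measure in the plane and in space\<close>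

lemma vector_2_eq_axis: "(vector [x, y] :: real^2) = x *\<^sub>R axis 1 1 + y *\<^sub>R axis 2 1"
  by (simp add: vec_eq_iff forall_2 vector_2 axis_def)

lemma vector_3_eq_axis:
  "(vector [x, y, z] :: real^3) = x *\<^sub>R axis 1 1 + y *\<^sub>R axis 2 1 + z *\<^sub>R axis 3 1"
  by (simp add: vec_eq_iff forall_3 vector_3 axis_def)

lemma continuous_on_vector_2 [continuous_intros]:
  fixes f g :: "'a::topological_space \<Rightarrow> real"
  assumes "continuous_on S f" "continuous_on S g"
  shows "continuous_on S (\<lambda>x. vector [f x, g x] :: real^2)"
  unfolding vector_2_eq_axis by (intro continuous_intros assms)

lemma continuous_on_vector_3 [continuous_intros]:
  fixes f g h :: "'a::topological_space \<Rightarrow> real"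
  assumes "continuous_on S f" "continuous_on S g" "continuous_on S h"
  shows "continuous_on S (\<lambda>x. vector [f x, g x, h x] :: real^3)"
  unfolding vector_3_eq_axis by (intro continuous_intros assms)

lemma measurable_vector_2 [measurable]:
  assumes [measurable]: "f \<in> borel_measurable M" "g \<in> borel_measurable M"
  shows "(\<lambda>x. vector [f x, g x] :: real^2) \<in> borel_measurable M"
  unfolding vector_2_eq_axis by measurable

lemma measurable_vector_3 [measurable]:
  assumes [measurable]: "f \<in> borel_measurable M" "g \<in> borel_measurable M" "h \<in> borel_measurable M"
  shows "(\<lambda>x. vector [f x, g x, h x] :: real^3) \<in> borel_measurable M"
  unfolding vector_3_eq_axis by measurable

lemma Basis_vec_2: "(Basis :: (real^2) set) = {axis 1 1, axis 2 1}"
  by (auto simp: Basis_vec_def UNIV_2)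

lemma Basis_vec_3: "(Basis :: (real^3) set) = {axis 1 1, axis 2 1, axis 3 1}"
  by (auto simp: Basis_vec_def UNIV_3)

lemma axis_neq: "(axis 1 1 :: real^2) \<noteq> axis 2 1" "(axis 1 1 :: real^3) \<noteq> axis 2 1"
   "(axis 1 1 :: real^3) \<noteq> axis 3 1"  "(axis 2 1 :: real^3) \<noteq> axis 3 1"
  by (simp_all add: axis_eq_axis)

text \<open>A Borel measure that gives every box the product of its side lengths is
  \<open>lborel\<close>. This and its analogue for space carry iterated integration over to
  coordinate vectors.\<close>

lemma lborel_real2:
  "(lborel :: (real^2) measure) = distr (lborel \<Otimes>\<^sub>M lborel) borel (\<lambda>p. vector [fst p, snd p])"
proof (rule lborel_eqI)
  fix l u :: "real^2" assume le: "\<And>b. b \<in> Basis \<Longrightarrow> l \<bullet> b \<le> u \<bullet> b"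
  have eq: "(\<lambda>p. vector [fst p, snd p] :: real^2) -` box l u \<inter> space (lborel \<Otimes>\<^sub>M lborel) =
      {l $ 1 <..< u $ 1} \<times> {l $ 2 <..< u $ 2}"
    by (auto simp: box_def Basis_vec_2 inner_axis space_pair_measure)
  have "l $ 1 \<le> u $ 1" "l $ 2 \<le> u $ 2"
    using le[of "axis 1 1"] le[of "axis 2 1"] by (simp_all add: Basis_vec_2 inner_axis)
  then show "emeasure (distr (lborel \<Otimes>\<^sub>M lborel) borel (\<lambda>p. vector [fst p, snd p])) (box l u) =
      ennreal (\<Prod>b\<in>Basis. (u - l) \<bullet> b)"
    by (subst emeasure_distr, simp, simp, subst eq,
        simp add: lborel.emeasure_pair_measure_Times Basis_vec_2 inner_axis axis_neq ennreal_mult)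
qed simp

lemma lborel_real3:
  "(lborel :: (real^3) measure) = distr (lborel \<Otimes>\<^sub>M (lborel \<Otimes>\<^sub>M lborel)) borel
     (\<lambda>p. vector [fst p, fst (snd p), snd (snd p)])"
proof (rule lborel_eqI)
  fix l u :: "real^3" assume le: "\<And>b. b \<in> Basis \<Longrightarrow> l \<bullet> b \<le> u \<bullet> b"
  have eq: "(\<lambda>p. vector [fst p, fst (snd p), snd (snd p)] :: real^3) -` box l u
        \<inter> space (lborel \<Otimes>\<^sub>M (lborel \<Otimes>\<^sub>M lborel)) =
      {l $ 1 <..< u $ 1} \<times> ({l $ 2 <..< u $ 2} \<times> {l $ 3 <..< u $ 3})"
    by (auto simp: box_def Basis_vec_3 inner_axis space_pair_measure)
  have sf: "sigma_finite_measure (lborel \<Otimes>\<^sub>M lborel :: (real \<times> real) measure)"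
    by (simp add: lborel_prod sigma_finite_lborel)
  have "l $ 1 \<le> u $ 1" "l $ 2 \<le> u $ 2" "l $ 3 \<le> u $ 3"
    using le[of "axis 1 1"] le[of "axis 2 1"] le[of "axis 3 1"] by (simp_all add: Basis_vec_3 inner_axis)
  then show "emeasure (distr (lborel \<Otimes>\<^sub>M (lborel \<Otimes>\<^sub>M lborel)) borel
       (\<lambda>p. vector [fst p, fst (snd p), snd (snd p)])) (box l u) =
      ennreal (\<Prod>b\<in>Basis. (u - l) \<bullet> b)"
    by (subst emeasure_distr, simp, simp, subst eq, subst sigma_finite_measure.emeasure_pair_measure_Times[OF sf],
        simp_all add: lborel.emeasure_pair_measure_Times Basis_vec_3 inner_axis axis_neq ennreal_mult)
qed simp

lemma nn_integral_real2:
  fixes f :: "real^2 \<Rightarrow> ennreal"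
  assumes [measurable]: "f \<in> borel_measurable borel"
  shows "(\<integral>\<^sup>+u. f u \<partial>lborel) = (\<integral>\<^sup>+x. \<integral>\<^sup>+y. f (vector [x, y]) \<partial>lborel \<partial>lborel)"
  by (subst lborel_real2, subst nn_integral_distr, simp, simp, subst lborel.nn_integral_fst[symmetric], simp_all)

lemma nn_integral_real3:
  fixes f :: "real^3 \<Rightarrow> ennreal"
  assumes [measurable]: "f \<in> borel_measurable borel"
  shows "(\<integral>\<^sup>+u. f u \<partial>lborel) =
     (\<integral>\<^sup>+x. \<integral>\<^sup>+y. \<integral>\<^sup>+z. f (vector [x, y, z]) \<partial>lborel \<partial>lborel \<partial>lborel)"
proof -
  have sf: "sigma_finite_measure (lborel \<Otimes>\<^sub>M lborel :: (real \<times> real) measure)"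
    by (simp add: lborel_prod sigma_finite_lborel)
  show ?thesis
    by (subst lborel_real3, subst nn_integral_distr, simp, simp,
     subst sigma_finite_measure.nn_integral_fst[OF sf, symmetric], simp,
     subst lborel.nn_integral_fst[symmetric], simp_all)
qed

text \<open>The area of an image is at most the integral of the absolute Jacobian, which counts
  overlaps repeatedly. The factor \<theta> is the ratio by which a Riemannian area density dominates
  the Jacobian.\<close>

lemma area_image_le:
  fixes \<phi> :: "real^2 \<Rightarrow> real^2"
  assumes K: "K \<in> lmeasurable"
    and d: "\<And>x. x \<in> K \<Longrightarrow> (\<phi> has_derivative \<phi>' x) (at x within K)"
    and le: "(\<integral>\<^sup>+u\<in>K. ennreal (\<theta> * \<bar>det (matrix (\<phi>' u))\<bar>) \<partial>lborel) \<le> ennreal N"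
    and "\<theta> > 0" "N \<ge> 0"
    and img: "\<phi> ` K \<in> sets borel"
  shows "emeasure lborel (\<phi> ` K) \<le> ennreal (N / \<theta>)"
proof -
  let ?J = "\<lambda>x. \<bar>det (matrix (\<phi>' x))\<bar>"
  have m: "(\<lambda>x. \<theta> * ?J x) \<in> borel_measurable (lebesgue_on K)"
    using borel_measurable_det_Jacobian[of K \<phi> \<phi>'] K d by (auto simp: fmeasurableD)
  have eq: "(\<integral>\<^sup>+x. ennreal (\<theta> * ?J x) \<partial>lebesgue_on K) = (\<integral>\<^sup>+u\<in>K. ennreal (\<theta> * ?J u) \<partial>lborel)"
    by (subst nn_integral_restrict_space) (use K in \<open>auto simp: nn_integral_completion fmeasurableD\<close>)
  \<comment> \<open>The density is measurable, so the finite bound \<open>N\<close> yields the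
    integrability on which the change-of-variables inequality rests.\<close>
  have i: "integrable (lebesgue_on K) (\<lambda>x. \<theta> * ?J x)"
    by (rule integrableI_bounded[OF m]) (use eq le \<open>\<theta> > 0\<close> in \<open>auto simp: order_le_less_trans abs_mult\<close>)
  have i': "integrable (lebesgue_on K) ?J"
    using integrable_mult_right[of "1 / \<theta>", OF i] \<open>\<theta> > 0\<close> by simp
  have int: "?J integrable_on K"
    using integrable_on_lebesgue_on[OF i'] K by (simp add: fmeasurableD)
  have "\<theta> * integral K ?J = \<theta> * lebesgue_integral (lebesgue_on K) ?J"
    using lebesgue_integral_eq_integral[OF i'] K by (simp add: fmeasurableD)
  also have "\<dots> = lebesgue_integral (lebesgue_on K) (\<lambda>x. \<theta> * ?J x)" by simp
  also have "\<dots> \<le> N"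
    using nn_integral_eq_integral[OF i] eq le \<open>N \<ge> 0\<close> \<open>\<theta> > 0\<close> by simp
  finally have "integral K ?J \<le> N / \<theta>"
    using \<open>\<theta> > 0\<close> by (simp add: field_simps)
  then have "measure lebesgue (\<phi> ` K) \<le> N / \<theta>"
    using measure_differentiable_image[OF fmeasurableD[OF K] d int] by simp
  moreover have "\<phi> ` K \<in> lmeasurable"
    using measurable_differentiable_image[OF fmeasurableD[OF K] d int] .
  ultimately have "emeasure lebesgue (\<phi> ` K) \<le> ennreal (N / \<theta>)"
    by (simp add: emeasure_eq_measure2 ennreal_leI)
  then show ?thesis using img by simp
qed

lemma emeasure_linear_image_2:
  fixes f :: "real^2 \<Rightarrow> real^2"
  assumes "linear f" "B \<in> lmeasurable"
  shows "emeasure lebesgue (f ` B) = ennreal \<bar>det (matrix f)\<bar> * emeasure lebesgue B"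
  using measure_linear_image[OF assms] measurable_linear_image[OF assms] assms(2)
  by (simp add: emeasure_eq_measure2 ennreal_mult')

section \<open>Slicing by horizontal lines\<close>

text \<open>A point of \<open>B\<close> encodes a line in the (y, z)-plane by slope and intercept.
  Two heights over \<open>y\<close> and \<open>y'\<close> determine such a line, and passing from
  the line to its two heights is linear with determinant \<open>y - y'\<close>, so a linear image of
  \<open>B\<close> covers the product of the slices.\<close>

lemma slice_product_le:
  fixes A A' :: "real set" and B :: "(real^2) set"
  assumes A [measurable]: "A \<in> sets borel" "A' \<in> sets borel" and B: "B \<in> sets borel" "B \<in> lmeasurable"
    and "y \<noteq> y'"
    and in_B: "\<And>z z'. z \<in> A \<Longrightarrow> z' \<in> A' \<Longrightarrow>
      vector [(z' - z) / (y' - y), z - (z' - z) / (y' - y) * y] \<in> B"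
  shows "emeasure lborel A * emeasure lborel A' \<le> ennreal \<bar>y' - y\<bar> * emeasure lborel B"
proof -
  define f :: "real^2 \<Rightarrow> real^2" where "f u = vector [u $ 2 + u $ 1 * y, u $ 2 + u $ 1 * y']" for u
  have lin: "linear f"
    by (rule linearI) (simp_all add: f_def vec_eq_iff forall_2 algebra_simps)
  have det: "\<bar>det (matrix f)\<bar> = \<bar>y' - y\<bar>"
    by (simp add: det_2 matrix_def f_def axis_def abs_minus_commute)
  define C :: "(real^2) set" where "C = {u. u $ 1 \<in> A \<and> u $ 2 \<in> A'}"
  have C [measurable]: "C \<in> sets borel"
    unfolding C_def by measurable
  have "C \<subseteq> f ` B"
  proof
    fix u assume "u \<in> C"
    let ?x = "(u $ 2 - u $ 1) / (y' - y)"
    have "vector [?x, u $ 1 - ?x * y] \<in> B"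
      using in_B[of "u $ 1" "u $ 2"] \<open>u \<in> C\<close> by (simp add: C_def)
    moreover have "f (vector [?x, u $ 1 - ?x * y]) = u"
      using \<open>y \<noteq> y'\<close> by (simp add: f_def vec_eq_iff forall_2 divide_simps) (simp add: algebra_simps)
    ultimately show "u \<in> f ` B" by (metis imageI)
  qed
  have "emeasure lborel A * emeasure lborel A' =
      (\<integral>\<^sup>+z. \<integral>\<^sup>+z'. indicator A z * indicator A' z' \<partial>lborel \<partial>lborel)"
    by (simp add: nn_integral_cmult nn_integral_multc)
  also have "\<dots> = (\<integral>\<^sup>+u. indicator C u \<partial>lborel)"
    by (subst nn_integral_real2) (auto intro!: nn_integral_cong simp: C_def indicator_def)
  also have "\<dots> = emeasure lebesgue C" by simp
  also have "\<dots> \<le> emeasure lebesgue (f ` B)"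
    by (rule emeasure_mono[OF \<open>C \<subseteq> f ` B\<close>])
       (use measurable_linear_image[OF lin B(2)] in \<open>simp add: fmeasurableD\<close>)
  also have "\<dots> = ennreal \<bar>y' - y\<bar> * emeasure lborel B"
    using emeasure_linear_image_2[OF lin B(2)] det B(1) by simp
  finally show ?thesis .
qed

text \<open>\<^term>\<open>BX\<close> and \<^term>\<open>BY\<close> parametrize the exceptional integral curves of the fields
  \<open>\<partial>\<^sub>x\<close> and \<open>\<partial>\<^sub>y + x \<partial>\<^sub>z\<close>, by their invariants \<open>(y, z)\<close> and \<open>(x, z - x y)\<close>.\<close>

lemma slicing:
  fixes R\<^sub>1 R\<^sub>2 :: "(real^3) set" and BX BY :: "(real^2) set" and \<eta> \<kappa> :: real
  defines "Q \<equiv> {p :: real^3. \<bar>p $ 1\<bar> \<le> 1/2 \<and> \<bar>p $ 2\<bar> \<le> 1/8 \<and> \<bar>p $ 3\<bar> \<le> 1/16}"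
  assumes R [measurable]: "R\<^sub>1 \<in> sets borel" "R\<^sub>2 \<in> sets borel"
    and B [measurable]: "BX \<in> sets borel" "BY \<in> sets borel"
    and eX: "emeasure lborel BX \<le> ennreal \<eta>" and eY: "emeasure lborel BY \<le> ennreal \<eta>"
    and \<eta>: "0 \<le> \<eta>" "\<eta> < 1/128"
    and cover: "\<And>y z. \<bar>y\<bar> \<le> 1/2 \<Longrightarrow> \<bar>z\<bar> \<le> 1/16 \<Longrightarrow> vector [y, z] \<notin> BX \<Longrightarrow>
        vector [0, y, z] \<in> R\<^sub>1 \<union> R\<^sub>2"
    and HX: "\<And>R x x' y z. R \<in> {R\<^sub>1, R\<^sub>2} \<Longrightarrow> \<bar>x\<bar> \<le> 1/2 \<Longrightarrow> \<bar>x'\<bar> \<le> 1/2 \<Longrightarrow> \<bar>y\<bar> \<le> 1/2 \<Longrightarrow> \<bar>z\<bar> \<le> 1/16 \<Longrightarrow>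
        vector [y, z] \<notin> BX \<Longrightarrow> vector [x, y, z] \<in> R \<Longrightarrow> vector [x', y, z] \<in> R"
    and HY: "\<And>x y z y' z'. \<bar>x\<bar> \<le> 1/2 \<Longrightarrow> \<bar>y\<bar> \<le> 1/2 \<Longrightarrow> \<bar>z\<bar> \<le> 1/16 \<Longrightarrow> \<bar>y'\<bar> \<le> 1/2 \<Longrightarrow> \<bar>z'\<bar> \<le> 1/16 \<Longrightarrow>
        z - x * y = z' - x * y' \<Longrightarrow> vector [x, y, z] \<in> R\<^sub>1 \<Longrightarrow> vector [x, y', z'] \<in> R\<^sub>2 \<Longrightarrow>
        vector [x, z - x * y] \<in> BY"
    and big: "ennreal \<kappa> \<le> emeasure lborel (R\<^sub>1 \<inter> Q)" "ennreal \<kappa> \<le> emeasure lborel (R\<^sub>2 \<inter> Q)"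
  shows "\<kappa> \<le> 6 * \<eta>"
proof (rule ccontr)
  assume \<kappa>: "\<not> \<kappa> \<le> 6 * \<eta>"
  define Z :: "real set" where "Z = {-1/16..1/16}"
  \<comment> \<open>By \<open>HX\<close>, a height in \<open>A R y\<close> with \<bar>y\<bar> \<le>
    1/2 puts the whole X-segment \<bar>x\<bar> \<le> 1/2 over it into \<open>R\<close>, so a test at
    x = 0 is enough. \<open>b y\<close> collects the exceptional heights.\<close>
  define A where "A R y = {z \<in> Z. vector [y, z] \<notin> BX \<and> vector [0, y, z] \<in> R}" for R :: "(real^3) set" and y
  define b where "b y = {z \<in> Z. vector [y, z] \<in> BX}" for y
  have Z_iff: "z \<in> Z \<longleftrightarrow> \<bar>z\<bar> \<le> 1/16" for z
    unfolding Z_def by auto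
  have [measurable]: "Z \<in> sets borel" by (simp add: Z_def)
  have A_meas [measurable]: "A R y \<in> sets borel" if "R \<in> {R\<^sub>1, R\<^sub>2}" for R y
  proof -
    have [measurable]: "R \<in> sets borel" using that R by auto
    show ?thesis unfolding A_def by measurable
  qed
  have b_meas [measurable]: "b y \<in> sets borel" for y
    unfolding b_def by measurable
  have bmeas': "(\<lambda>y. emeasure lborel (b y)) \<in> borel_measurable borel"
  proof -
    have "(\<integral>\<^sup>+z. indicator Z z * indicator BX (vector [y, z]) \<partial>lborel) = emeasure lborel (b y)" for y
    proof -
      have "(\<integral>\<^sup>+z. indicator Z z * indicator BX (vector [y, z]) \<partial>lborel) =
          (\<integral>\<^sup>+z. indicator (b y) z \<partial>lborel)"
        by (intro nn_integral_cong) (auto simp: b_def indicator_def)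
      then show ?thesis by simp
    qed
    moreover have "(\<lambda>y. \<integral>\<^sup>+z. indicator Z z * indicator BX (vector [y, z]) \<partial>lborel) \<in> borel_measurable borel"
      by measurable
    ultimately show ?thesis by simp
  qed
  have b_int: "(\<integral>\<^sup>+y. emeasure lborel (b y) \<partial>lborel) \<le> ennreal \<eta>"
  proof -
    have "(\<integral>\<^sup>+y. emeasure lborel (b y) \<partial>lborel) =
        (\<integral>\<^sup>+y. \<integral>\<^sup>+z. indicator (b y) z \<partial>lborel \<partial>lborel)" by simp
    also have "\<dots> \<le> (\<integral>\<^sup>+y. \<integral>\<^sup>+z. indicator BX (vector [y, z]) \<partial>lborel \<partial>lborel)"
      by (intro nn_integral_mono) (auto simp: b_def indicator_def)
    also have "\<dots> = emeasure lborel BX"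
      by (subst nn_integral_real2[symmetric]) auto
    finally show ?thesis using eX by order
  qed
  have fin: "emeasure lborel S = ennreal (measure lborel S)" if "S \<subseteq> Z" "S \<in> sets borel" for S
  proof (rule emeasure_eq_ennreal_measure)
    have "emeasure lborel S \<le> emeasure lborel Z" using that by (intro emeasure_mono) auto
    then show "emeasure lborel S \<noteq> top" by (auto simp: Z_def top_unique)
  qed
  have subZ: "A R y \<subseteq> Z" "b y \<subseteq> Z" for R y by (auto simp: A_def b_def)
  \<comment> \<open>The box \<open>Q\<close> has width 1 in x and 1/4 in y. If all its slices had
    measure at most 20 \<eta>, then \<open>R \<inter> Q\<close> would have volume at most 1/4 * 20
    \<eta> plus \<eta> for the exceptional lines, that is 6 \<eta>, which is less than
    \<kappa>.\<close>
  have large: "\<exists>y. \<bar>y\<bar> \<le> 1/8 \<and> 20 * \<eta> < measure lborel (A R y)" if R12: "R \<in> {R\<^sub>1, R\<^sub>2}" for R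
  proof (rule ccontr)
    assume "\<not> ?thesis"
    then have small: "emeasure lborel (A R y) \<le> ennreal (20 * \<eta>)" if "\<bar>y\<bar> \<le> 1/8" for y
      using that fin[OF subZ(1) A_meas[OF R12]] by (auto intro: ennreal_leI simp: not_less)
    have RQ: "R \<inter> Q \<in> sets borel"
    proof -
      have "Q \<in> sets borel" unfolding Q_def by measurable
      then show ?thesis using R12 R by auto
    qed
    have "ennreal \<kappa> \<le> emeasure lborel (R \<inter> Q)" using big R12 by auto
    also have "\<dots> = (\<integral>\<^sup>+x. \<integral>\<^sup>+y. \<integral>\<^sup>+z. indicator (R \<inter> Q) (vector [x, y, z]) \<partial>lborel \<partial>lborel \<partial>lborel)"
      using RQ by (subst nn_integral_real3[symmetric]) auto
    also have "\<dots> \<le> (\<integral>\<^sup>+x. \<integral>\<^sup>+y. \<integral>\<^sup>+z. indicator {-1/2..1/2::real} x * (indicator {-1/8..1/8::real} y *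
        (indicator (A R y) z + indicator (b y) z)) \<partial>lborel \<partial>lborel \<partial>lborel)"
    proof (intro nn_integral_mono)
      fix x y z :: real
      show "indicator (R \<inter> Q) (vector [x, y, z] :: real^3) \<le> (indicator {-1/2..1/2::real} x *
        (indicator {-1/8..1/8::real} y * (indicator (A R y) z + indicator (b y) z)) :: ennreal)"
      proof (cases "vector [x, y, z] \<in> R \<inter> Q")
        case True
        then have *: "\<bar>x\<bar> \<le> 1/2" "\<bar>y\<bar> \<le> 1/8" "\<bar>z\<bar> \<le> 1/16" "vector [x, y, z] \<in> R"
          by (auto simp: Q_def)
        have "z \<in> A R y \<or> z \<in> b y"
          using HX[OF R12, of x 0 y z] * by (auto simp: A_def b_def Z_iff)
        with * True show ?thesis by (auto simp: indicator_def)
      qed simp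
    qed
    also have "\<dots> = (\<integral>\<^sup>+x. indicator {-1/2..1/2::real} x * (\<integral>\<^sup>+y. indicator {-1/8..1/8::real} y *
        (emeasure lborel (A R y) + emeasure lborel (b y)) \<partial>lborel) \<partial>lborel)"
    proof -
      have 1: "(\<integral>\<^sup>+z. indicator {-1/2..1/2::real} x * (indicator {-1/8..1/8::real} y * (indicator (A R y) z + indicator (b y) z)) \<partial>lborel)
        = indicator {-1/2..1/2::real} x * (indicator {-1/8..1/8::real} y * (emeasure lborel (A R y) + emeasure lborel (b y)))"
        for x y :: real
        using A_meas[OF R12] by (simp add: nn_integral_cmult nn_integral_add)
      \<comment> \<open>A factor with values 0 and 1 comes out of the integral for every
        \<open>f\<close>; the slices of \<open>R\<close> carry no fact on measurability in
        y.\<close>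
      have 2: "(\<integral>\<^sup>+y. indicator {-1/2..1/2::real} x * f y \<partial>lborel) = indicator {-1/2..1/2::real} x * (\<integral>\<^sup>+y. f y \<partial>lborel)"
        for x :: real and f
        by (auto simp: indicator_def)
      show ?thesis unfolding 1 2 ..
    qed
    also have "\<dots> = (\<integral>\<^sup>+y. indicator {-1/8..1/8::real} y *
        (emeasure lborel (A R y) + emeasure lborel (b y)) \<partial>lborel)"
      by (simp add: nn_integral_multc)
    also have "\<dots> \<le> (\<integral>\<^sup>+y. ennreal (20 * \<eta>) * indicator {-1/8..1/8::real} y + emeasure lborel (b y) \<partial>lborel)"
      by (intro nn_integral_mono) (auto simp: indicator_def intro!: add_mono small)
    also have "\<dots> = ennreal (20 * \<eta>) * ennreal (1/4) + (\<integral>\<^sup>+y. emeasure lborel (b y) \<partial>lborel)"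
      using bmeas' by (subst nn_integral_add) (auto simp: nn_integral_cmult_indicator)
    also have "\<dots> \<le> ennreal (20 * \<eta>) * ennreal (1/4) + ennreal \<eta>"
      by (intro add_mono b_int order_refl)
    also have "\<dots> = ennreal (6 * \<eta>)"
      using \<eta> by (subst ennreal_mult[symmetric]) (auto simp flip: ennreal_plus)
    finally show False using \<kappa> \<eta> by (auto simp: ennreal_le_iff)
  qed
  \<comment> \<open>The interval for \<open>y'\<close> has length 1/8 and keeps away from
    \<bar>y\<bar> \<le> 1/8. Exceptional heights of measure above 1/16 over all of it would give
    \<open>BX\<close> area at least 1/128, against the bound on \<eta>.\<close>
  have "\<exists>y'. 3/8 \<le> y' \<and> y' \<le> 1/2 \<and> measure lborel (b y') \<le> 1/16"
  proof (rule ccontr)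
    assume "\<not> ?thesis"
    then have "1/16 \<le> measure lborel (b y)" if "3/8 \<le> y" "y \<le> 1/2" for y
      using that by (meson less_imp_le not_le)
    then have "ennreal (1/16) * indicator {3/8..1/2::real} y \<le> emeasure lborel (b y)" for y
      using fin[OF subZ(2) b_meas, of y] by (auto simp: indicator_def intro!: ennreal_leI)
    then have "(\<integral>\<^sup>+y. ennreal (1/16) * indicator {3/8..1/2::real} y \<partial>lborel) \<le> ennreal \<eta>"
      by (intro order_trans[OF nn_integral_mono b_int]) auto
    then have "ennreal (1/16) * ennreal (1/8) \<le> ennreal \<eta>"
      by (simp add: nn_integral_cmult_indicator)
    then show False using \<eta> by (subst (asm) ennreal_mult[symmetric]) auto
  qed
  then obtain y' where y': "3/8 \<le> y'" "y' \<le> 1/2" "measure lborel (b y') \<le> 1/16" by blast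
  \<comment> \<open>Of the heights over \<open>y'\<close>, of total length 1/8, at most 1/16 are
    exceptional, so one region gets at least 1/32. It becomes \<open>R'\<close>; then
    \<open>y\<close> is chosen so that the other region \<open>R\<close> has a large slice over
    it.\<close>
  have "1/8 \<le> measure lborel (A R\<^sub>1 y') + measure lborel (A R\<^sub>2 y') + measure lborel (b y')"
  proof -
    have "Z \<subseteq> (A R\<^sub>1 y' \<union> A R\<^sub>2 y') \<union> b y'"
    proof
      fix z assume "z \<in> Z"
      then show "z \<in> (A R\<^sub>1 y' \<union> A R\<^sub>2 y') \<union> b y'"
        using cover[of y' z] y' by (auto simp: A_def b_def Z_iff)
    qed
    then have "emeasure lborel Z \<le> emeasure lborel ((A R\<^sub>1 y' \<union> A R\<^sub>2 y') \<union> b y')"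
      by (intro emeasure_mono) auto
    also have "\<dots> \<le> emeasure lborel (A R\<^sub>1 y') + emeasure lborel (A R\<^sub>2 y') + emeasure lborel (b y')"
      by (intro order_trans[OF emeasure_subadditive] add_mono) auto
    finally have "ennreal (1/8) \<le> emeasure lborel (A R\<^sub>1 y') + emeasure lborel (A R\<^sub>2 y') + emeasure lborel (b y')"
      by (simp add: Z_def)
    then show ?thesis
      using fin[OF subZ(1) A_meas] fin[OF subZ(2) b_meas] by (simp flip: ennreal_plus)
  qed
  then consider "1/32 \<le> measure lborel (A R\<^sub>2 y')" | "1/32 \<le> measure lborel (A R\<^sub>1 y')"
    using y' by linarith
  then obtain R R' where RR: "(R = R\<^sub>1 \<and> R' = R\<^sub>2) \<or> (R = R\<^sub>2 \<and> R' = R\<^sub>1)"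
    and y'32: "1/32 \<le> measure lborel (A R' y')"
    by metis
  from RR have RR': "R \<in> {R\<^sub>1, R\<^sub>2}" "R' \<in> {R\<^sub>1, R\<^sub>2}" by auto
  from large[OF RR'(1)] obtain y where y: "\<bar>y\<bar> \<le> 1/8" "20 * \<eta> < measure lborel (A R y)" by blast
  have yy: "1/4 \<le> y' - y" "y' - y \<le> 5/8" "\<bar>y'\<bar> \<le> 1/2" "\<bar>y\<bar> \<le> 1/2" using y y' by (auto simp: abs_le_iff)
  \<comment> \<open>Every pair of heights from the two slices is joined by a Y-line that passes from
    \<open>R\<close> to \<open>R'\<close> and is therefore exceptional.\<close>
  have "emeasure lborel (A R y) * emeasure lborel (A R' y') \<le> ennreal \<bar>y' - y\<bar> * emeasure lborel BY"
  proof (rule slice_product_le)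
    show "BY \<in> lmeasurable"
      using eY by (intro fmeasurableI) (auto simp: order_le_less_trans)
    show "y \<noteq> y'" using yy by auto
    fix z z' assume z: "z \<in> A R y" "z' \<in> A R' y'"
    define x where "x = (z' - z) / (y' - y)"
    have zz: "\<bar>z\<bar> \<le> 1/16" "\<bar>z'\<bar> \<le> 1/16" using z by (auto simp: A_def Z_iff)
    \<comment> \<open>The heights differ by at most 1/8 and \<open>y' - y\<close> is at least 1/4,
      so the slope x stays within 1/2.\<close>
    have "\<bar>z' - z\<bar> \<le> 1/2 * (y' - y)"
      using abs_triangle_ineq4[of z' z] zz yy(1) by argo
    then have x: "\<bar>x\<bar> \<le> 1/2" using yy by (simp add: x_def divide_le_eq)
    have eq: "z - x * y = z' - x * y'"
      using yy by (simp add: x_def field_simps)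
    have "vector [x, y, z] \<in> R" "vector [x, y', z'] \<in> R'"
      using HX[OF RR'(1), of 0 x y z] HX[OF RR'(2), of 0 x y' z'] z x yy zz by (auto simp: A_def)
    then have "vector [x, z - x * y] \<in> BY"
      using RR HY[of x y z y' z'] HY[of x y' z' y z] x yy zz eq by metis
    then show "vector [(z' - z) / (y' - y), z - (z' - z) / (y' - y) * y] \<in> BY"
      by (simp add: x_def)
  qed (use A_meas RR' B in auto)
  also have "\<dots> \<le> ennreal (5/8) * ennreal \<eta>"
    using yy by (intro mult_mono eY ennreal_leI) auto
  finally have "measure lborel (A R y) * measure lborel (A R' y') \<le> 5/8 * \<eta>"
    using fin[OF subZ(1) A_meas[OF RR'(1)], of y] fin[OF subZ(1) A_meas[OF RR'(2)], of y'] \<eta>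
    by (simp flip: ennreal_mult)
  \<comment> \<open>The product of the slices is at most 5/8 * \<eta>. Since one factor is at least
    1/32, at most 20 \<eta> is left for the other, against the choice of \<open>y\<close>.\<close>
  moreover have "measure lborel (A R y) * (1/32) \<le> measure lborel (A R y) * measure lborel (A R' y')"
    by (intro mult_left_mono y'32) auto
  ultimately show False using y by linarith
qed

section \<open>Smoothness of polynomial maps\<close>

lemma real_polynomial_function_frechet_derivative:
  assumes "real_polynomial_function p"
  shows "real_polynomial_function (\<lambda>x. frechet_derivative p (at x) v)"
  using assms
proof induction
  case (linear f)
  then have "frechet_derivative f (at x) = f" for x
    by (metis bounded_linear_imp_has_derivative frechet_derivative_at)
  then show ?case by auto
next
  case (const c)
  then show ?case by auto
next
  case (add f g)
  then have "frechet_derivative (\<lambda>x. f x + g x) (at x) =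
      (\<lambda>v. frechet_derivative f (at x) v + frechet_derivative g (at x) v)" for x
    by (intro frechet_derivative_at[symmetric] has_derivative_add)
       (auto simp flip: frechet_derivative_works intro: differentiable_at_real_polynomial_function)
  with add.IH show ?case by auto
next
  case (mult f g)
  then have "frechet_derivative (\<lambda>x. f x * g x) (at x) =
      (\<lambda>v. f x * frechet_derivative g (at x) v + frechet_derivative f (at x) v * g x)" for x
    by (intro frechet_derivative_at[symmetric] has_derivative_mult)
       (auto simp flip: frechet_derivative_works intro: differentiable_at_real_polynomial_function)
  with mult show ?case by auto
qed

text \<open>Directional derivatives of polynomial maps are again polynomial, component by component,
  so the induction on \<open>k\<close> stays inside the class.\<close>

lemma Ck_on_polynomial_function:
  fixes f :: "'a::euclidean_space \<Rightarrow> 'b::euclidean_space"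
  assumes "polynomial_function f"
  shows "Ck_on k f UNIV"
  using assms
proof (induction k arbitrary: f)
  case 0
  then show ?case by (simp add: continuous_on_polymonial_function)
next
  case (Suc k)
  have d: "f differentiable (at x)" for x
    using Suc.prems differentiable_at_polynomial_function by blast
  have "polynomial_function (\<lambda>x. frechet_derivative f (at x) v)" for v
    unfolding polynomial_function_iff_Basis_inner
  proof
    fix b :: 'b assume "b \<in> Basis"
    then have "real_polynomial_function (\<lambda>x. f x \<bullet> b)"
      using Suc.prems polynomial_function_iff_Basis_inner by blast
    then have "real_polynomial_function (\<lambda>x. frechet_derivative (\<lambda>x. f x \<bullet> b) (at x) v)"
      by (rule real_polynomial_function_frechet_derivative)
    moreover have "frechet_derivative (\<lambda>x. f x \<bullet> b) (at x) = (\<lambda>v. frechet_derivative f (at x) v \<bullet> b)" for x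
      using d by (intro frechet_derivative_at[symmetric] has_derivative_inner_left)
        (auto simp flip: frechet_derivative_works)
    ultimately show "real_polynomial_function (\<lambda>x. frechet_derivative f (at x) v \<bullet> b)" by simp
  qed
  then show ?case using d Suc.IH by auto
qed

section \<open>The metric\<close>

text \<open>The Gram matrix of \<open>dx\<^sup>2 + dy\<^sup>2 + \<tau>\<^sup>2 (dz - x dy)\<^sup>2\<close>.\<close>

definition heisenberg_form :: "real \<Rightarrow> real^3 \<Rightarrow> real^3^3" where
  "heisenberg_form \<tau> p = vector [vector [1, 0, 0],
     vector [0, 1 + \<tau>\<^sup>2 * (p $ 1)\<^sup>2, - (\<tau>\<^sup>2 * p $ 1)], vector [0, - (\<tau>\<^sup>2 * p $ 1), \<tau>\<^sup>2]]"

lemma heisenberg_form_inner: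
  "v \<bullet> (heisenberg_form \<tau> p *v w) =
     v $ 1 * w $ 1 + v $ 2 * w $ 2 + \<tau>\<^sup>2 * (v $ 3 - p $ 1 * v $ 2) * (w $ 3 - p $ 1 * w $ 2)"
  by (simp add: heisenberg_form_def inner_vec_def matrix_vector_mult_def sum_3 algebra_simps power2_eq_square)

lemma det_scaleR_heisenberg_form: "det (c *\<^sub>R heisenberg_form \<tau> p) = c ^ 3 * \<tau>\<^sup>2"
  by (simp add: heisenberg_form_def det_3 algebra_simps power2_eq_square power3_eq_cube)

text \<open>The pulled-back form is the Gram matrix of the images of the two basis vectors. The
  off-diagonal entries are kept apart because \<open>G\<close> is an arbitrary matrix.\<close>

lemma det_gram_2:
  fixes D :: "real^2 \<Rightarrow> real^3" and G :: "real^3^3"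
  shows "det (transpose (matrix D) ** G ** matrix D) =
     (D (axis 1 1) \<bullet> (G *v D (axis 1 1))) * (D (axis 2 1) \<bullet> (G *v D (axis 2 1))) -
     (D (axis 1 1) \<bullet> (G *v D (axis 2 1))) * (D (axis 2 1) \<bullet> (G *v D (axis 1 1)))"
proof -
  have "(transpose (matrix D) ** G ** matrix D) $ i $ j = D (axis i 1) \<bullet> (G *v D (axis j 1))" for i j
    by (simp add: matrix_matrix_mult_def transpose_def matrix_def matrix_vector_mult_def inner_vec_def
        sum_3 algebra_simps)
  then show ?thesis by (simp add: det_2)
qed

text \<open>In the coframe dx, dy, \<tau> (dz - x dy) the form is Euclidean, so the Gram determinant
  is the sum of the squares of three 2 by 2 minors, and each minor alone is a lower bound. The first
  bound keeps the Jacobian of the invariants (y, z) of X-lines. The second keeps that of the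
  invariants (x, z - x y) of Y-lines, where the y dx part of d(z - x y) drops out against
  dx.\<close>

lemma det_gram_heisenberg_ge:
  fixes D :: "real^2 \<Rightarrow> real^3"
  defines "a \<equiv> D (axis 1 1)" and "b \<equiv> D (axis 2 1)"
  assumes "\<tau> \<ge> 0"
  shows "l\<^sup>2 * \<tau> * \<bar>a $ 2 * b $ 3 - b $ 2 * a $ 3\<bar> \<le>
      sqrt (det (transpose (matrix D) ** (l\<^sup>2 *\<^sub>R heisenberg_form \<tau> p) ** matrix D))"
    and "l\<^sup>2 * \<tau> * \<bar>a $ 1 * (b $ 3 - p $ 1 * b $ 2) - b $ 1 * (a $ 3 - p $ 1 * a $ 2)\<bar> \<le>
      sqrt (det (transpose (matrix D) ** (l\<^sup>2 *\<^sub>R heisenberg_form \<tau> p) ** matrix D))"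
proof -
  let ?m1 = "a $ 1 * b $ 2 - b $ 1 * a $ 2"
  let ?m2 = "a $ 2 * b $ 3 - b $ 2 * a $ 3"
  let ?m3 = "a $ 1 * (b $ 3 - p $ 1 * b $ 2) - b $ 1 * (a $ 3 - p $ 1 * a $ 2)"
  have eq: "det (transpose (matrix D) ** (l\<^sup>2 *\<^sub>R heisenberg_form \<tau> p) ** matrix D) =
      (l\<^sup>2)\<^sup>2 * (?m1\<^sup>2 + \<tau>\<^sup>2 * ?m2\<^sup>2 + \<tau>\<^sup>2 * ?m3\<^sup>2)"
    unfolding det_gram_2 a_def[symmetric] b_def[symmetric]
    by (simp add: scaleR_matrix_vector_assoc[symmetric] heisenberg_form_inner) algebra
  have *: "l\<^sup>2 * \<tau> * \<bar>m\<bar> = sqrt ((l\<^sup>2)\<^sup>2 * (\<tau>\<^sup>2 * m\<^sup>2))" for m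
    unfolding real_sqrt_mult real_sqrt_abs using assms(3) by simp
  show "l\<^sup>2 * \<tau> * \<bar>?m2\<bar> \<le> sqrt (det (transpose (matrix D) ** (l\<^sup>2 *\<^sub>R heisenberg_form \<tau> p) ** matrix D))"
    "l\<^sup>2 * \<tau> * \<bar>?m3\<bar> \<le> sqrt (det (transpose (matrix D) ** (l\<^sup>2 *\<^sub>R heisenberg_form \<tau> p) ** matrix D))"
    unfolding eq * by (auto intro!: real_sqrt_le_mono mult_left_mono)
qed

lemma heisenberg_form_le:
  assumes "\<bar>p $ 1\<bar> \<le> 1"
  shows "v \<bullet> (heisenberg_form \<tau> p *v v) \<le> (1 + 2 * \<tau>\<^sup>2) * (norm v)\<^sup>2"
proof -
  have x: "(p $ 1)\<^sup>2 \<le> 1" using assms by (simp add: abs_square_le_1)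
  have "(v $ 3 - p $ 1 * v $ 2)\<^sup>2 \<le> 2 * ((v $ 3)\<^sup>2 + (p $ 1 * v $ 2)\<^sup>2)"
    using zero_le_power2[of "v $ 3 + p $ 1 * v $ 2"] by (simp add: power2_eq_square algebra_simps)
  also have "\<dots> \<le> 2 * ((v $ 3)\<^sup>2 + 1 * (v $ 2)\<^sup>2)"
    unfolding power_mult_distrib by (intro mult_left_mono add_left_mono mult_right_mono x) auto
  also have "\<dots> \<le> 2 * (norm v)\<^sup>2" by (simp add: norm_sq_3)
  finally have "\<tau>\<^sup>2 * (v $ 3 - p $ 1 * v $ 2)\<^sup>2 \<le> \<tau>\<^sup>2 * (2 * (norm v)\<^sup>2)"
    by (intro mult_left_mono) auto
  moreover have "(v $ 1)\<^sup>2 + (v $ 2)\<^sup>2 \<le> (norm v)\<^sup>2" by (simp add: norm_sq_3)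
  ultimately show ?thesis
    unfolding heisenberg_form_inner by (simp add: power2_eq_square algebra_simps)
qed

lemma heisenberg_form_pos:
  assumes "v \<noteq> 0" "\<tau> \<noteq> 0"
  shows "0 < v \<bullet> (heisenberg_form \<tau> p *v v)"
proof -
  have eq: "v \<bullet> (heisenberg_form \<tau> p *v v) = (v $ 1)\<^sup>2 + (v $ 2)\<^sup>2 + (\<tau> * (v $ 3 - p $ 1 * v $ 2))\<^sup>2"
    unfolding heisenberg_form_inner by (simp add: power2_eq_square algebra_simps)
  have "0 \<le> v \<bullet> (heisenberg_form \<tau> p *v v)" unfolding eq by simp
  moreover have "v \<bullet> (heisenberg_form \<tau> p *v v) \<noteq> 0"
  proof
    assume "v \<bullet> (heisenberg_form \<tau> p *v v) = 0"
    then have "v $ 1 = 0" "v $ 2 = 0" "\<tau> * (v $ 3 - p $ 1 * v $ 2) = 0"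
      unfolding eq by (auto simp: add_nonneg_eq_0_iff)
    with assms show False by (auto simp: vec_eq_iff forall_3)
  qed
  ultimately show ?thesis by simp
qed

text \<open>Hadamard's inequality: dropping the square of the off-diagonal entry leaves the product
  of two squared lengths, each bounded by \<open>heisenberg_form_le\<close>.\<close>

lemma det_gram_heisenberg_le:
  fixes D :: "real^2 \<Rightarrow> real^3"
  assumes "\<bar>p $ 1\<bar> \<le> 1"
  shows "sqrt (det (transpose (matrix D) ** (l\<^sup>2 *\<^sub>R heisenberg_form \<tau> p) ** matrix D)) \<le>
     l\<^sup>2 * (1 + 2 * \<tau>\<^sup>2) * (norm (D (axis 1 1)) * norm (D (axis 2 1)))"
proof -
  let ?a = "D (axis 1 1)" and ?b = "D (axis 2 1)" and ?H = "heisenberg_form \<tau> p"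
  have sym: "?a \<bullet> (?H *v ?b) = ?b \<bullet> (?H *v ?a)"
    by (simp add: heisenberg_form_inner algebra_simps)
  have nn: "0 \<le> v \<bullet> (?H *v v)" for v
    by (simp add: heisenberg_form_inner mult.assoc)
  have "det (transpose (matrix D) ** (l\<^sup>2 *\<^sub>R ?H) ** matrix D) =
      (l\<^sup>2)\<^sup>2 * ((?a \<bullet> (?H *v ?a)) * (?b \<bullet> (?H *v ?b)) - (?b \<bullet> (?H *v ?a))\<^sup>2)"
    unfolding det_gram_2 by (simp add: scaleR_matrix_vector_assoc[symmetric] sym algebra_simps power2_eq_square)
  also have "\<dots> \<le> (l\<^sup>2)\<^sup>2 * ((?a \<bullet> (?H *v ?a)) * (?b \<bullet> (?H *v ?b)))"
    by (intro mult_left_mono) auto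
  also have "\<dots> \<le> (l\<^sup>2)\<^sup>2 * (((1 + 2 * \<tau>\<^sup>2) * (norm ?a)\<^sup>2) * ((1 + 2 * \<tau>\<^sup>2) * (norm ?b)\<^sup>2))"
    by (intro mult_left_mono mult_mono heisenberg_form_le assms nn) auto
  also have "\<dots> = (l\<^sup>2 * (1 + 2 * \<tau>\<^sup>2) * (norm ?a * norm ?b))\<^sup>2"
    by (simp add: power_mult_distrib power2_eq_square)
  finally show ?thesis
    by (intro real_le_lsqrt) auto
qed

definition squeezed_metric :: "nat \<Rightarrow> real \<Rightarrow> real \<Rightarrow> real^3 \<Rightarrow> real^3^3" where
  "squeezed_metric m T \<epsilon> p =
     ((\<epsilon> + (1 - (norm p)\<^sup>2) ^ m) / T)\<^sup>2 *\<^sub>R heisenberg_form (T ^ 3) p"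

text \<open>The weight uses the squared norm, so every entry is a polynomial and smoothness holds on
  all of space. On the ball the weight is at least \<epsilon>, which keeps the form
  definite.\<close>

lemma riemannian_metric_squeezed_metric:
  assumes "T > 0" "\<epsilon> > 0"
  shows "riemannian_metric (squeezed_metric m T \<epsilon>)"
proof -
  have coord: "real_polynomial_function (\<lambda>p :: real^3. p $ i)" for i
    by (rule real_polynomial_function.intros(1)) (rule bounded_linear_vec_nth)
  have nrm: "real_polynomial_function (\<lambda>p :: real^3. (norm p)\<^sup>2)"
    unfolding norm_sq_3 using coord by (intro real_polynomial_function.intros(3) real_polynomial_function_power)
  have entry: "real_polynomial_function (\<lambda>p. heisenberg_form (T ^ 3) p $ i $ j)" for i j
  proof -
    have "\<forall>i j. real_polynomial_function (\<lambda>p. heisenberg_form (T ^ 3) p $ i $ j)"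
      unfolding forall_3 heisenberg_form_def
      using coord by (auto intro!: real_polynomial_function_minus real_polynomial_function.intros(4)
         real_polynomial_function.intros(3) real_polynomial_function_power)
    then show ?thesis by blast
  qed
  have "real_polynomial_function (\<lambda>p. squeezed_metric m T \<epsilon> p $ i $ j)" for i j
    unfolding squeezed_metric_def vector_scaleR_component
    using nrm entry by (auto intro!: real_polynomial_function.intros(4) real_polynomial_function_power
       real_polynomial_function_divide real_polynomial_function.intros(3) real_polynomial_function_diff)
  then have "polynomial_function (squeezed_metric m T \<epsilon>)"
    unfolding polynomial_function_iff_Basis_inner by (auto simp: Basis_vec_def inner_axis)
  then have "smooth_on M3 (squeezed_metric m T \<epsilon>)"
    unfolding smooth_on_def by (intro exI[of _ UNIV] exI[of _ "squeezed_metric m T \<epsilon>"])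
      (auto intro: Ck_on_polynomial_function)
  moreover have "transpose (squeezed_metric m T \<epsilon> p) = squeezed_metric m T \<epsilon> p" for p
    by (simp add: squeezed_metric_def heisenberg_form_def vec_eq_iff forall_3 transpose_def)
  moreover have "0 < v \<bullet> (squeezed_metric m T \<epsilon> p *v v)" if "p \<in> M3" "v \<noteq> 0" for p v
  proof -
    have "(norm p)\<^sup>2 \<le> 1" using that by (simp add: abs_square_le_1)
    then have "0 < \<epsilon> + (1 - (norm p)\<^sup>2) ^ m"
      using assms by (intro add_pos_nonneg) auto
    then have "0 < ((\<epsilon> + (1 - (norm p)\<^sup>2) ^ m) / T)\<^sup>2"
      using assms by (intro zero_less_power divide_pos_pos)
    then show ?thesis
      using heisenberg_form_pos[OF \<open>v \<noteq> 0\<close>, of "T ^ 3" p] assms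
      by (simp add: squeezed_metric_def scaleR_matrix_vector_assoc[symmetric])
  qed
  ultimately show ?thesis by (simp add: riemannian_metric_def)
qed

text \<open>In dimension 3 the conformal factor contributes \<open>(w / T) ^ 6\<close> to the
  determinant and the stretching contributes \<open>T ^ 6\<close>. This cancellation is the reason
  for the stretching factor \<open>T ^ 3\<close>.\<close>

lemma sqrt_det_squeezed_metric:
  assumes "T > 0" "\<epsilon> > 0" "p \<in> M3"
  shows "sqrt (det (squeezed_metric m T \<epsilon> p)) = (\<epsilon> + (1 - (norm p)\<^sup>2) ^ m) ^ 3"
proof -
  let ?w = "\<epsilon> + (1 - (norm p)\<^sup>2) ^ m"
  have "(norm p)\<^sup>2 \<le> 1" using assms by (simp add: abs_square_le_1)
  then have w: "0 \<le> ?w" using assms by simp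
  have "det (squeezed_metric m T \<epsilon> p) = (?w ^ 3)\<^sup>2"
    unfolding squeezed_metric_def det_scaleR_heisenberg_form
    using assms(1) by (simp add: power_divide power_mult[symmetric])
  then have "sqrt (det (squeezed_metric m T \<epsilon> p)) = \<bar>?w ^ 3\<bar>"
    by (simp only: real_sqrt_abs)
  then show ?thesis using w by simp
qed

section \<open>Diameter\<close>

text \<open>A pointwise speed bound off a finite set passes easily through joins and reversals,
  unlike the length integral. The squared form avoids square roots, and the existential derivative
  is what the chain rule supplies.\<close>

definition curve_speed_le :: "(real^3 \<Rightarrow> real^3^3) \<Rightarrow> real \<Rightarrow> (real \<Rightarrow> real^3) \<Rightarrow> bool" where
  "curve_speed_le g C \<gamma> \<longleftrightarrow> valid_path \<gamma> \<and> path_image \<gamma> \<subseteq> M3 \<and>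
     (\<exists>S. finite S \<and> (\<forall>t\<in>{0..1} - S. \<exists>v. (\<gamma> has_vector_derivative v) (at t) \<and> v \<bullet> (g (\<gamma> t) *v v) \<le> C\<^sup>2))"

lemma quadratic_scaleR: "(c *\<^sub>R v) \<bullet> (A *v (c *\<^sub>R v)) = c\<^sup>2 * (v \<bullet> (A *v v))"
  for v :: "real^'n"
  by (simp add: matrix_vector_mult_scaleR power2_eq_square)

text \<open>The exceptional set is null and the parameter interval has length 1.\<close>

lemma curve_length_le:
  assumes "curve_speed_le g C \<gamma>" "C \<ge> 0"
  shows "curve_length g \<gamma> \<le> ennreal C"
proof -
  from assms obtain S where S: "finite S" and v: "\<And>t. t \<in> {0..1} - S \<Longrightarrow>
      \<exists>v. (\<gamma> has_vector_derivative v) (at t) \<and> v \<bullet> (g (\<gamma> t) *v v) \<le> C\<^sup>2"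
    unfolding curve_speed_le_def by blast
  have "S \<in> null_sets lborel" using S by (rule finite_imp_null_set_lborel)
  then have "AE t in lborel. t \<notin> S" by (rule AE_not_in)
  then have "curve_length g \<gamma> \<le> (\<integral>\<^sup>+t. ennreal C * indicator {0..1::real} t \<partial>lborel)"
    unfolding curve_length_def
  proof (intro nn_integral_mono_AE, elim eventually_mono)
    fix t :: real assume t: "t \<notin> S"
    show "ennreal (sqrt (vector_derivative \<gamma> (at t) \<bullet> (g (\<gamma> t) *v vector_derivative \<gamma> (at t)))) *
        indicator {0..1} t \<le> ennreal C * indicator {0..1} t"
    proof (cases "t \<in> {0..1}")
      case True
      with t v obtain w where "(\<gamma> has_vector_derivative w) (at t)" "w \<bullet> (g (\<gamma> t) *v w) \<le> C\<^sup>2" by blast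
      then show ?thesis
        using \<open>C \<ge> 0\<close> True by (simp add: vector_derivative_at real_le_lsqrt ennreal_leI)
    qed simp
  qed
  also have "\<dots> = ennreal C" by (simp add: nn_integral_cmult_indicator)
  finally show ?thesis .
qed

lemma riemannian_dist_le:
  assumes "curve_speed_le g C \<gamma>" "C \<ge> 0" "pathstart \<gamma> = p" "pathfinish \<gamma> = q"
  shows "riemannian_dist g p q \<le> ennreal C"
proof -
  have "riemannian_dist g p q \<le> curve_length g \<gamma>"
    unfolding riemannian_dist_def using assms
    by (intro INF_lower) (auto simp: curve_speed_le_def valid_path_def)
  also have "\<dots> \<le> ennreal C" using curve_length_le assms by blast
  finally show ?thesis .
qed

text \<open>Each half of a join is traversed at twice its original speed, so the bound
  doubles.\<close>

lemma curve_speed_le_join: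
  assumes 1: "curve_speed_le g C \<gamma>\<^sub>1" and 2: "curve_speed_le g C \<gamma>\<^sub>2"
    and "pathfinish \<gamma>\<^sub>1 = pathstart \<gamma>\<^sub>2"
  shows "curve_speed_le g (2 * C) (\<gamma>\<^sub>1 +++ \<gamma>\<^sub>2)"
proof -
  from 1 obtain S\<^sub>1 where S1: "finite S\<^sub>1" and v1: "\<And>t. t \<in> {0..1} - S\<^sub>1 \<Longrightarrow>
      \<exists>v. (\<gamma>\<^sub>1 has_vector_derivative v) (at t) \<and> v \<bullet> (g (\<gamma>\<^sub>1 t) *v v) \<le> C\<^sup>2"
    unfolding curve_speed_le_def by blast
  from 2 obtain S\<^sub>2 where S2: "finite S\<^sub>2" and v2: "\<And>t. t \<in> {0..1} - S\<^sub>2 \<Longrightarrow>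
      \<exists>v. (\<gamma>\<^sub>2 has_vector_derivative v) (at t) \<and> v \<bullet> (g (\<gamma>\<^sub>2 t) *v v) \<le> C\<^sup>2"
    unfolding curve_speed_le_def by blast
  \<comment> \<open>The rescaled exceptional parameters of both pieces, together with the joint at
    1/2.\<close>
  define S where "S = insert (1/2) ((\<lambda>t. t / 2) ` S\<^sub>1 \<union> (\<lambda>t. (t + 1) / 2) ` S\<^sub>2)"
  have "\<exists>v. ((\<gamma>\<^sub>1 +++ \<gamma>\<^sub>2) has_vector_derivative v) (at t) \<and> v \<bullet> (g ((\<gamma>\<^sub>1 +++ \<gamma>\<^sub>2) t) *v v) \<le> (2 * C)\<^sup>2"
    if t: "t \<in> {0..1} - S" for t
  proof (cases "t < 1/2")
    case True
    have "t \<in> (\<lambda>t. t / 2) ` S\<^sub>1" if "2 * t \<in> S\<^sub>1"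
      using that by (intro image_eqI[of _ _ "2 * t"]) auto
    then have "2 * t \<notin> S\<^sub>1" using t by (auto simp: S_def)
    then obtain v where v: "(\<gamma>\<^sub>1 has_vector_derivative v) (at (2 * t))" "v \<bullet> (g (\<gamma>\<^sub>1 (2 * t)) *v v) \<le> C\<^sup>2"
      using v1[of "2 * t"] t True by auto
    have "((\<lambda>t. 2 * t) has_vector_derivative 2) (at t)"
      by (auto intro!: derivative_eq_intros simp: has_real_derivative_iff_has_vector_derivative[symmetric])
    then have "((\<gamma>\<^sub>1 \<circ> (\<lambda>t. 2 * t)) has_vector_derivative 2 *\<^sub>R v) (at t)"
      by (rule vector_diff_chain_at) (rule v)
    then have "((\<gamma>\<^sub>1 +++ \<gamma>\<^sub>2) has_vector_derivative 2 *\<^sub>R v) (at t)"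
      by (rule has_vector_derivative_transform_within_open[of _ _ _ "{..<1/2}"])
         (use True in \<open>auto simp: joinpaths_def\<close>)
    moreover have "(2 *\<^sub>R v) \<bullet> (g ((\<gamma>\<^sub>1 +++ \<gamma>\<^sub>2) t) *v (2 *\<^sub>R v)) \<le> (2 * C)\<^sup>2"
      unfolding quadratic_scaleR using v(2) True by (simp add: joinpaths_def power_mult_distrib)
    ultimately show ?thesis by blast
  next
    case False
    then have t2: "t > 1/2" using t by (auto simp: S_def)
    have "t \<in> (\<lambda>t. (t + 1) / 2) ` S\<^sub>2" if "2 * t - 1 \<in> S\<^sub>2"
      using that by (intro image_eqI[of _ _ "2 * t - 1"]) auto
    then have "2 * t - 1 \<notin> S\<^sub>2" using t by (auto simp: S_def)
    then obtain v where v: "(\<gamma>\<^sub>2 has_vector_derivative v) (at (2 * t - 1))" "v \<bullet> (g (\<gamma>\<^sub>2 (2 * t - 1)) *v v) \<le> C\<^sup>2"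
      using v2[of "2 * t - 1"] t t2 by auto
    have "((\<lambda>t. 2 * t - 1) has_vector_derivative 2) (at t)"
      by (auto intro!: derivative_eq_intros simp: has_real_derivative_iff_has_vector_derivative[symmetric])
    then have "((\<gamma>\<^sub>2 \<circ> (\<lambda>t. 2 * t - 1)) has_vector_derivative 2 *\<^sub>R v) (at t)"
      by (rule vector_diff_chain_at) (rule v)
    then have "((\<gamma>\<^sub>1 +++ \<gamma>\<^sub>2) has_vector_derivative 2 *\<^sub>R v) (at t)"
      by (rule has_vector_derivative_transform_within_open[of _ _ _ "{1/2<..}"])
         (use t2 in \<open>auto simp: joinpaths_def\<close>)
    moreover have "(2 *\<^sub>R v) \<bullet> (g ((\<gamma>\<^sub>1 +++ \<gamma>\<^sub>2) t) *v (2 *\<^sub>R v)) \<le> (2 * C)\<^sup>2"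
      unfolding quadratic_scaleR using v(2) t2 by (simp add: joinpaths_def power_mult_distrib)
    ultimately show ?thesis by blast
  qed
  moreover have "finite S" using S1 S2 by (simp add: S_def)
  ultimately show ?thesis
    using assms path_image_join_subset[of \<gamma>\<^sub>1 \<gamma>\<^sub>2] unfolding curve_speed_le_def
    by (auto intro!: valid_path_join)
qed

lemma curve_speed_le_reversepath:
  assumes "curve_speed_le g C \<gamma>"
  shows "curve_speed_le g C (reversepath \<gamma>)"
proof -
  from assms obtain S where S: "finite S" and v: "\<And>t. t \<in> {0..1} - S \<Longrightarrow>
      \<exists>v. (\<gamma> has_vector_derivative v) (at t) \<and> v \<bullet> (g (\<gamma> t) *v v) \<le> C\<^sup>2"
    unfolding curve_speed_le_def by blast
  have "\<exists>v. (reversepath \<gamma> has_vector_derivative v) (at t) \<and> v \<bullet> (g (reversepath \<gamma> t) *v v) \<le> C\<^sup>2"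
    if t: "t \<in> {0..1} - (\<lambda>t. 1 - t) ` S" for t
  proof -
    have "1 - t \<notin> S" using t by (auto simp: image_iff)
    then obtain v where v: "(\<gamma> has_vector_derivative v) (at (1 - t))" "v \<bullet> (g (\<gamma> (1 - t)) *v v) \<le> C\<^sup>2"
      using v[of "1 - t"] t by auto
    have "((\<lambda>t. 1 - t) has_vector_derivative -1) (at t)"
      by (auto intro!: derivative_eq_intros simp: has_real_derivative_iff_has_vector_derivative[symmetric])
    then have "((\<gamma> \<circ> (\<lambda>t. 1 - t)) has_vector_derivative (-1) *\<^sub>R v) (at t)"
      by (rule vector_diff_chain_at) (rule v)
    then show ?thesis
      using v(2) quadratic_scaleR[of "-1" v]
      by (intro exI[of _ "(-1) *\<^sub>R v"]) (simp add: reversepath_def o_def)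
  qed
  moreover have "finite ((\<lambda>t. 1 - t) ` S)" using S by simp
  ultimately show ?thesis
    using assms unfolding curve_speed_le_def by (auto intro!: valid_path_imp_reverse)
qed

lemma has_vector_derivative_vector_3:
  assumes "(f has_real_derivative f') (at t)" "(g has_real_derivative g') (at t)" "(h has_real_derivative h') (at t)"
  shows "((\<lambda>t. vector [f t, g t, h t] :: real^3) has_vector_derivative vector [f', g', h']) (at t)"
  using assms
  unfolding has_real_derivative_iff_has_vector_derivative vector_3_eq_axis has_vector_derivative_def
  by (auto intro!: derivative_eq_intros simp: algebra_simps)

section \<open>Short curves to a common boundary point\<close>

lemma squeezed_metric_inner_le:
  assumes "\<bar>p $ 1\<bar> \<le> 1"
  shows "v \<bullet> (squeezed_metric m T \<epsilon> p *v v) \<le>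
    ((\<epsilon> + (1 - (norm p)\<^sup>2) ^ m) / T)\<^sup>2 * ((1 + 2 * (T ^ 3)\<^sup>2) * (norm v)\<^sup>2)"
  using heisenberg_form_le[OF assms, of v "T ^ 3"]
  by (simp add: squeezed_metric_def scaleR_matrix_vector_assoc[symmetric] mult_left_mono)

text \<open>Every point is joined to the boundary by an integral curve of the horizontal field \<open>\<partial>\<^sub>x\<close>, whose
  length does not feel the stretching of the vertical direction.\<close>

lemma curve_to_pole:
  assumes T: "T > 0" and \<epsilon>: "\<epsilon> > 0" and m: "m > 0"
    and inner: "2 * (\<epsilon> + 1) \<le> T" and bd: "(\<epsilon> / T)\<^sup>2 * (1 + 2 * (T ^ 3)\<^sup>2) * 4 \<le> 1"
    and p: "p \<in> M3"
  shows "\<exists>\<gamma>. curve_speed_le (squeezed_metric m T \<epsilon>) 2 \<gamma> \<and> pathstart \<gamma> = p \<and> pathfinish \<gamma> = axis 1 1"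
proof -
  let ?g = "squeezed_metric m T \<epsilon>"
  have np: "(p $ 1)\<^sup>2 + (p $ 2)\<^sup>2 + (p $ 3)\<^sup>2 \<le> 1"
    using p norm_sq_3[of p] power_le_one[of "norm p" 2] by simp
  \<comment> \<open>Here \<open>r\<close> is the distance of \<open>p\<close> from the x-axis,
    \<phi> the angle at the origin between \<open>axis 1 1\<close> and the exit point
    \<open>q\<close> of the X-line through \<open>p\<close>, and (a, b) the unit direction of the
    last two coordinates, chosen arbitrarily when \<open>p\<close> lies on the axis.\<close>
  define r where "r = sqrt ((p $ 2)\<^sup>2 + (p $ 3)\<^sup>2)"
  have r2: "r\<^sup>2 = (p $ 2)\<^sup>2 + (p $ 3)\<^sup>2" by (simp add: r_def)
  have r0: "0 \<le> r" by (simp add: r_def)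
  have r1: "r \<le> 1"
    using np zero_le_power2[of "p $ 1"] unfolding r_def real_sqrt_le_1_iff by linarith
  define \<phi> where "\<phi> = arcsin r"
  have \<phi>: "sin \<phi> = r" "0 \<le> \<phi>" "\<phi> \<le> pi / 2" "cos \<phi> = sqrt (1 - r\<^sup>2)"
    using r0 r1 arcsin_bounded[of r] arcsin_le_arcsin[of 0 r] by (auto simp: \<phi>_def cos_arcsin)
  obtain a b where ab: "a\<^sup>2 + b\<^sup>2 = 1" "r * a = p $ 2" "r * b = p $ 3"
  proof (cases "r = 0")
    case True
    then have "p $ 2 = 0" "p $ 3 = 0" using r2 by (simp_all add: sum_power2_eq_zero_iff)
    with True show ?thesis by (intro that[of 1 0]) auto
  next
    case False
    have "(p $ 2 / r)\<^sup>2 + (p $ 3 / r)\<^sup>2 = ((p $ 2)\<^sup>2 + (p $ 3)\<^sup>2) / r\<^sup>2"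
      by (simp add: power_divide add_divide_distrib)
    also have "\<dots> = 1" unfolding r2[symmetric] using False by simp
    finally have "(p $ 2 / r)\<^sup>2 + (p $ 3 / r)\<^sup>2 = 1" .
    with False show ?thesis by (intro that[of "p $ 2 / r" "p $ 3 / r"]) auto
  qed
  define q :: "real^3" where "q = vector [cos \<phi>, p $ 2, p $ 3]"
  \<comment> \<open>A great-circle arc on the sphere from \<open>q\<close> to the pole
    \<open>axis 1 1\<close>, of constant Euclidean speed \<phi>.\<close>
  define \<gamma> :: "real \<Rightarrow> real^3" where
    "\<gamma> t = vector [cos ((1 - t) * \<phi>), sin ((1 - t) * \<phi>) * a, sin ((1 - t) * \<phi>) * b]" for t
  define \<gamma>' :: "real \<Rightarrow> real^3" where
    "\<gamma>' t = vector [sin ((1 - t) * \<phi>) * \<phi>, - (cos ((1 - t) * \<phi>) * \<phi> * a), - (cos ((1 - t) * \<phi>) * \<phi> * b)]" for t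
  have unit: "s\<^sup>2 * a\<^sup>2 + s\<^sup>2 * b\<^sup>2 = s\<^sup>2" for s
    using ab(1) by (simp add: distrib_left[symmetric])
  have n\<gamma>: "norm (\<gamma> t) = 1" for t
  proof -
    have "(norm (\<gamma> t))\<^sup>2 = 1"
      unfolding norm_sq_3 by (simp add: \<gamma>_def vector_3 power_mult_distrib unit add.assoc)
    then show ?thesis by (simp add: power2_eq_1_iff) (use norm_ge_zero[of "\<gamma> t"] in linarith)
  qed
  have n\<gamma>': "(norm (\<gamma>' t))\<^sup>2 = \<phi>\<^sup>2" for t
  proof -
    have "(norm (\<gamma>' t))\<^sup>2 = (sin ((1 - t) * \<phi>))\<^sup>2 * \<phi>\<^sup>2 + (cos ((1 - t) * \<phi>))\<^sup>2 * \<phi>\<^sup>2"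
      unfolding norm_sq_3 using unit[of "cos ((1 - t) * \<phi>) * \<phi>"]
      by (simp add: \<gamma>'_def vector_3 power_mult_distrib add.assoc)
    then show ?thesis by (simp add: distrib_right[symmetric])
  qed
  have deriv: "(\<gamma> has_vector_derivative \<gamma>' t) (at t)" for t
    unfolding \<gamma>_def \<gamma>'_def
    by (rule has_vector_derivative_vector_3) (auto intro!: derivative_eq_intros)
  \<comment> \<open>On the sphere the weight is just \<epsilon>, as \<open>m\<close> is positive.
    The Euclidean speed is at most pi / 2 < 2, whence the factor 4 in \<open>bd\<close>.\<close>
  have "curve_speed_le ?g 1 \<gamma>"
    unfolding curve_speed_le_def
  proof (intro conjI exI[of _ "{}"] ballI)
    have "continuous_on {0..1} \<gamma>'"
      unfolding \<gamma>'_def by (intro continuous_intros)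
    then have "\<gamma> C1_differentiable_on {0..1}"
      unfolding C1_differentiable_on_def using deriv by blast
    then show "valid_path \<gamma>"
      unfolding valid_path_def by (rule C1_differentiable_imp_piecewise)
    show "path_image \<gamma> \<subseteq> M3" by (auto simp: path_image_def n\<gamma>)
    fix t
    have "\<bar>\<gamma> t $ 1\<bar> \<le> 1" using component_le_norm_cart[of "\<gamma> t" 1] n\<gamma> by simp
    then have "\<gamma>' t \<bullet> (?g (\<gamma> t) *v \<gamma>' t) \<le> (\<epsilon> / T)\<^sup>2 * ((1 + 2 * (T ^ 3)\<^sup>2) * (norm (\<gamma>' t))\<^sup>2)"
      using squeezed_metric_inner_le[of "\<gamma> t" "\<gamma>' t" m T \<epsilon>] m by (simp add: n\<gamma> zero_power)
    also have "\<dots> \<le> (\<epsilon> / T)\<^sup>2 * ((1 + 2 * (T ^ 3)\<^sup>2) * 4)"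
    proof -
      have "\<phi>\<^sup>2 \<le> 2\<^sup>2" using \<phi> pi_half_less_two by (intro power_mono) auto
      then show ?thesis unfolding n\<gamma>' by (intro mult_left_mono) auto
    qed
    also have "\<dots> \<le> 1\<^sup>2" using bd by (simp add: mult.assoc)
    finally show "\<exists>v. (\<gamma> has_vector_derivative v) (at t) \<and> v \<bullet> (?g (\<gamma> t) *v v) \<le> 1\<^sup>2"
      using deriv by blast
  qed simp
  moreover have "curve_speed_le ?g 1 (linepath p q)"
    unfolding curve_speed_le_def
  proof (intro conjI exI[of _ "{}"] ballI)
    have "q = \<gamma> 0" using \<phi> ab by (simp add: q_def \<gamma>_def)
    then have "q \<in> M3" using n\<gamma>[of 0] by simp
    then show sub: "path_image (linepath p q) \<subseteq> M3"
      using p by (simp add: closed_segment_subset)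
    fix t :: real assume t: "t \<in> {0..1} - {}"
    define x where "x = linepath p q t"
    have "x \<in> M3" using sub t unfolding path_image_def x_def by blast
    then have x: "(norm x)\<^sup>2 \<le> 1" by (simp add: abs_square_le_1)
    have w: "0 \<le> \<epsilon> + (1 - (norm x)\<^sup>2) ^ m" "\<epsilon> + (1 - (norm x)\<^sup>2) ^ m \<le> \<epsilon> + 1"
      using x \<epsilon> by (auto intro!: power_le_one)
    have d: "\<bar>cos \<phi> - p $ 1\<bar> \<le> 2"
    proof -
      have "\<bar>p $ 1\<bar> \<le> 1" using component_le_norm_cart[of p 1] p by simp
      then show ?thesis using abs_cos_le_one[of \<phi>] by linarith
    qed
    \<comment> \<open>The segment has constant y and z, so the stretched term vanishes. Its
      Euclidean length is at most 2, and the factor 1 / T makes up for it by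
      \<open>inner\<close>.\<close>
    have "(q - p) \<bullet> (?g x *v (q - p)) = ((\<epsilon> + (1 - (norm x)\<^sup>2) ^ m) / T)\<^sup>2 * (cos \<phi> - p $ 1)\<^sup>2"
      by (simp add: squeezed_metric_def scaleR_matrix_vector_assoc[symmetric] heisenberg_form_inner q_def
          power2_eq_square)
    also have "\<dots> = ((\<epsilon> + (1 - (norm x)\<^sup>2) ^ m) / T * \<bar>cos \<phi> - p $ 1\<bar>)\<^sup>2"
      unfolding power_mult_distrib power2_abs ..
    also have "\<dots> \<le> ((\<epsilon> + 1) / T * 2)\<^sup>2"
      using w d T by (intro power_mono mult_mono divide_right_mono) auto
    also have "\<dots> \<le> 1\<^sup>2"
      using inner T \<epsilon> by (intro power_mono) (auto simp: field_simps)
    finally have "(q - p) \<bullet> (?g (linepath p q t) *v (q - p)) \<le> 1\<^sup>2" by (simp add: x_def)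
    then show "\<exists>v. (linepath p q has_vector_derivative v) (at t) \<and> v \<bullet> (?g (linepath p q t) *v v) \<le> 1\<^sup>2"
      using has_vector_derivative_linepath_within by blast
  qed simp_all
  moreover have "pathfinish (linepath p q) = pathstart \<gamma>"
    using \<phi> ab by (simp add: q_def \<gamma>_def pathstart_def)
  ultimately have "curve_speed_le ?g (2 * 1) (linepath p q +++ \<gamma>)"
    by (intro curve_speed_le_join)
  moreover have "pathfinish \<gamma> = axis 1 1"
    by (simp add: \<gamma>_def pathfinish_def vec_eq_iff forall_3 axis_def)
  ultimately show ?thesis
    by (intro exI[of _ "linepath p q +++ \<gamma>"]) simp
qed

text \<open>Any two points are joined through the common pole; joining two curves of speed at most 2
  gives speed at most 4.\<close>

lemma diameter_squeezed_metric_le: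
  assumes "T > 0" "\<epsilon> > 0" "m > 0"
    and "2 * (\<epsilon> + 1) \<le> T" and "(\<epsilon> / T)\<^sup>2 * (1 + 2 * (T ^ 3)\<^sup>2) * 4 \<le> 1"
  shows "riemannian_diameter (squeezed_metric m T \<epsilon>) \<le> 4"
  unfolding riemannian_diameter_def
proof (intro SUP_least)
  let ?g = "squeezed_metric m T \<epsilon>"
  fix p q :: "real^3" assume "p \<in> M3" "q \<in> M3"
  then obtain \<gamma> \<delta> where
    "curve_speed_le ?g 2 \<gamma>" "pathstart \<gamma> = p" "pathfinish \<gamma> = axis 1 1"
    "curve_speed_le ?g 2 \<delta>" "pathstart \<delta> = q" "pathfinish \<delta> = axis 1 1"
    using curve_to_pole[OF assms] by metis
  note * = this
  have "curve_speed_le ?g (2 * 2) (\<gamma> +++ reversepath \<delta>)"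
    using * by (intro curve_speed_le_join curve_speed_le_reversepath) simp_all
  moreover have "pathstart (\<gamma> +++ reversepath \<delta>) = p" "pathfinish (\<gamma> +++ reversepath \<delta>) = q"
    using * by simp_all
  ultimately have "riemannian_dist ?g p q \<le> ennreal (2 * 2)"
    by (intro riemannian_dist_le[of _ _ "\<gamma> +++ reversepath \<delta>"]) simp_all
  then show "riemannian_dist ?g p q \<le> 4" by simp
qed

section \<open>Boundary area\<close>

lemma nn_integral_inverse_1_plus_square_finite:
  "(\<integral>\<^sup>+x. ennreal (1 / (1 + x\<^sup>2)) \<partial>lborel) < (top :: ennreal)"
proof -
  have lim: "(arctan \<longlongrightarrow> pi / 2) at_top" by (rule tendsto_arctan_at_top)
  have d: "DERIV arctan x :> 1 / (1 + x\<^sup>2)" for x :: real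
    by (auto intro!: derivative_eq_intros simp: inverse_eq_divide)
  have half: "(\<integral>\<^sup>+x. ennreal (1 / (1 + x\<^sup>2)) * indicator {0..} x \<partial>lborel) = ennreal (pi / 2 - arctan 0)"
    by (rule nn_integral_FTC_atLeast[OF _ d _ lim]) (auto intro!: add_nonneg_nonneg)
  have "(\<integral>\<^sup>+x. ennreal (1 / (1 + x\<^sup>2)) \<partial>lborel) \<le>
      (\<integral>\<^sup>+x. ennreal (1 / (1 + x\<^sup>2)) * indicator {0..} x +
        ennreal (1 / (1 + x\<^sup>2)) * indicator {..0} x \<partial>lborel)"
    by (intro nn_integral_mono) (auto simp: indicator_def)
  also have "\<dots> = (\<integral>\<^sup>+x. ennreal (1 / (1 + x\<^sup>2)) * indicator {0..} x \<partial>lborel) +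
      (\<integral>\<^sup>+x. ennreal (1 / (1 + x\<^sup>2)) * indicator {..0} x \<partial>lborel)"
    by (rule nn_integral_add) auto
  also have "(\<integral>\<^sup>+x. ennreal (1 / (1 + x\<^sup>2)) * indicator {..0} x \<partial>lborel) =
      (\<integral>\<^sup>+x. ennreal (1 / (1 + x\<^sup>2)) * indicator {0..} x \<partial>lborel)"
    by (subst lborel_distr_uminus[symmetric], subst nn_integral_distr)
       (auto intro!: nn_integral_cong simp: indicator_def)
  finally show ?thesis unfolding half by (simp add: order_le_less_trans)
qed

text \<open>The integrand is dominated by a product of one-variable densities with finite integral.
  Finiteness is the point: \<epsilon> is chosen later to absorb the value.\<close>

lemma nn_integral_stereo_density_finite:
  "(\<integral>\<^sup>+(u::real^2). ennreal (4 / (1 + (norm u)\<^sup>2)\<^sup>2) \<partial>lborel) < (top :: ennreal)"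
proof -
  let ?J = "\<integral>\<^sup>+x. ennreal (1 / (1 + x\<^sup>2)) \<partial>lborel :: ennreal"
  have le: "4 / (1 + (norm u)\<^sup>2)\<^sup>2 \<le> 4 * (1 / (1 + (u $ 1)\<^sup>2) * (1 / (1 + (u $ 2)\<^sup>2)))" for u :: "real^2"
  proof -
    have "0 \<le> (u $ 1)\<^sup>2" "0 \<le> (u $ 2)\<^sup>2" by auto
    then have "(1 + (u $ 1)\<^sup>2) * (1 + (u $ 2)\<^sup>2) \<le> (1 + (norm u)\<^sup>2)\<^sup>2"
      unfolding norm_sq_2 by (simp add: power2_eq_square[of "1 + _"] algebra_simps)
    moreover have "0 < (1 + (u $ 1)\<^sup>2) * (1 + (u $ 2)\<^sup>2)"
      by (intro mult_pos_pos add_pos_nonneg) auto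
    ultimately have "4 / (1 + (norm u)\<^sup>2)\<^sup>2 \<le> 4 / ((1 + (u $ 1)\<^sup>2) * (1 + (u $ 2)\<^sup>2))"
      by (intro divide_left_mono mult_pos_pos add_pos_nonneg) auto
    then show ?thesis by simp
  qed
  have "(\<integral>\<^sup>+(u::real^2). ennreal (4 / (1 + (norm u)\<^sup>2)\<^sup>2) \<partial>lborel) \<le>
      (\<integral>\<^sup>+(u::real^2). 4 * (ennreal (1 / (1 + (u $ 1)\<^sup>2)) * ennreal (1 / (1 + (u $ 2)\<^sup>2))) \<partial>lborel)"
  proof (intro nn_integral_mono)
    fix u :: "real^2"
    have "ennreal (4 * (1 / (1 + (u $ 1)\<^sup>2) * (1 / (1 + (u $ 2)\<^sup>2)))) =
        4 * (ennreal (1 / (1 + (u $ 1)\<^sup>2)) * ennreal (1 / (1 + (u $ 2)\<^sup>2)))"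
      by (subst ennreal_mult, simp, simp, subst ennreal_mult, simp_all)
    then show "ennreal (4 / (1 + (norm u)\<^sup>2)\<^sup>2) \<le> 4 * (ennreal (1 / (1 + (u $ 1)\<^sup>2)) * ennreal (1 / (1 + (u $ 2)\<^sup>2)))"
      using ennreal_leI[OF le[of u]] by simp
  qed
  also have "\<dots> = 4 * (?J * ?J)"
    by (subst nn_integral_real2) (simp_all add: nn_integral_cmult nn_integral_multc)
  also have "\<dots> < top"
    using nn_integral_inverse_1_plus_square_finite by (simp add: ennreal_mult_less_top)
  finally show ?thesis .
qed

lemma stereo_has_derivative:
  "(stereo has_derivative (\<lambda>v. (2 / (1 + (norm u)\<^sup>2)) *\<^sub>R vector [v $ 1, v $ 2, 0] -
      (4 * (u \<bullet> v) / (1 + (norm u)\<^sup>2)\<^sup>2) *\<^sub>R vector [u $ 1, u $ 2, -1])) (at u)"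
proof -
  have pos: "1 + (norm u)\<^sup>2 \<noteq> 0" for u :: "real^2"
    using zero_le_power2[of "norm u"] by linarith
  \<comment> \<open>In this form, a scalar multiple of (u, -1) shifted by the north pole, only a
    scalar function and an affine map have to be differentiated.\<close>
  have eq: "stereo = (\<lambda>u. (2 / (1 + u \<bullet> u)) *\<^sub>R vector [u $ 1, u $ 2, -1] + axis 3 1)"
    using pos by (auto simp: fun_eq_iff stereo_def vec_eq_iff forall_3 axis_def field_simps power2_norm_eq_inner)
  have 1: "((\<lambda>u. vector [u $ 1, u $ 2, -1] :: real^3) has_derivative (\<lambda>v. vector [v $ 1, v $ 2, 0])) (at u)"
    unfolding vector_3_eq_axis by (auto intro!: derivative_eq_intros bounded_linear_imp_has_derivative bounded_linear_vec_nth)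
  have 2: "((\<lambda>u. 2 / (1 + u \<bullet> u)) has_derivative (\<lambda>v. - (4 * (u \<bullet> v) / (1 + u \<bullet> u)\<^sup>2))) (at u)"
    using pos[of u] unfolding power2_norm_eq_inner
    by (auto intro!: derivative_eq_intros simp: fun_eq_iff field_simps power2_eq_square inner_commute)
  show ?thesis
    unfolding eq power2_norm_eq_inner
    by (rule has_derivative_eq_rhs, rule has_derivative_add_const, rule has_derivative_scaleR[OF 2 1])
       (simp add: fun_eq_iff)
qed

text \<open>Inverse stereographic projection is conformal: in the expansion of the squared norm the
  cross term cancels against the term with \<open>k\<^sup>2\<close>.\<close>

lemma norm_stereo_derivative:
  "norm (frechet_derivative stereo (at u) v) = 2 * norm v / (1 + (norm u)\<^sup>2)"
proof -
  define c where "c = 1 + (norm u)\<^sup>2"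
  have c: "c > 0" unfolding c_def by (intro add_pos_nonneg) auto
  let ?D = "frechet_derivative stereo (at u) v"
  define k where "k = 4 * (u \<bullet> v) / c\<^sup>2"
  have D: "?D = (2 / c) *\<^sub>R vector [v $ 1, v $ 2, 0] - k *\<^sub>R vector [u $ 1, u $ 2, -1]"
    unfolding c_def k_def frechet_derivative_at[OF stereo_has_derivative, symmetric] ..
  have uv: "u \<bullet> v = u $ 1 * v $ 1 + u $ 2 * v $ 2" by (simp add: inner_vec_def sum_2)
  have c': "(u $ 1)\<^sup>2 + (u $ 2)\<^sup>2 + 1 = c" by (simp add: c_def norm_sq_2)
  have "(norm ?D)\<^sup>2 = (2 / c)\<^sup>2 * (norm v)\<^sup>2 - 2 * (2 / c) * k * (u \<bullet> v) + k\<^sup>2 * ((u $ 1)\<^sup>2 + (u $ 2)\<^sup>2 + 1)"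
    unfolding norm_sq_3 norm_sq_2 uv D by (simp add: algebra_simps power2_eq_square)
  also have "\<dots> = (2 / c)\<^sup>2 * (norm v)\<^sup>2"
    unfolding c' k_def using c by (simp add: field_simps power2_eq_square)
  also have "\<dots> = (2 * norm v / c)\<^sup>2" by (simp add: power_divide power_mult_distrib)
  finally show ?thesis
    using c unfolding c_def[symmetric] by (subst (asm) power2_eq_iff_nonneg) auto
qed

text \<open>On the sphere the weight is \<epsilon>, and by conformality the norms of the two columns
  of the derivative have product \<open>4 / (1 + (norm u)\<^sup>2)\<^sup>2\<close>.\<close>

lemma boundary_area_squeezed_metric_le:
  assumes "m > 0"
  shows "boundary_area (squeezed_metric m T \<epsilon>) \<le>
     ennreal ((\<epsilon> / T)\<^sup>2 * (1 + 2 * (T ^ 3)\<^sup>2)) *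
       (\<integral>\<^sup>+(u::real^2). ennreal (4 / (1 + (norm u)\<^sup>2)\<^sup>2) \<partial>lborel)"
proof -
  have "ennreal (sqrt (det (pullback_metric (squeezed_metric m T \<epsilon>) stereo UNIV u))) \<le>
      ennreal ((\<epsilon> / T)\<^sup>2 * (1 + 2 * (T ^ 3)\<^sup>2)) * ennreal (4 / (1 + (norm u)\<^sup>2)\<^sup>2)" for u
  proof -
    have s: "norm (stereo u) = 1"
      using bij_betw_apply[OF bij_betw_stereo, of u] by simp
    then have "\<bar>stereo u $ 1\<bar> \<le> 1" using component_le_norm_cart[of "stereo u" 1] by simp
    from det_gram_heisenberg_le[OF this, of "frechet_derivative stereo (at u)" "\<epsilon> / T" "T ^ 3"]
    have "sqrt (det (pullback_metric (squeezed_metric m T \<epsilon>) stereo UNIV u)) \<le>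
        (\<epsilon> / T)\<^sup>2 * (1 + 2 * (T ^ 3)\<^sup>2) * (4 / (1 + (norm u)\<^sup>2)\<^sup>2)"
      unfolding norm_stereo_derivative using s assms
      by (simp add: pullback_metric_def squeezed_metric_def Let_def power2_eq_square zero_power)
    then show ?thesis
      by (subst ennreal_mult[symmetric]) (auto intro: ennreal_leI)
  qed
  then have "boundary_area (squeezed_metric m T \<epsilon>) \<le> (\<integral>\<^sup>+u. ennreal ((\<epsilon> / T)\<^sup>2 * (1 + 2 * (T ^ 3)\<^sup>2)) *
      ennreal (4 / (1 + (norm (u :: real^2))\<^sup>2)\<^sup>2) \<partial>lborel)"
    unfolding boundary_area_def surface_area_def by (intro nn_integral_mono) simp
  then show ?thesis by (simp add: nn_integral_cmult)
qed

section \<open>Disks of small area\<close>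

lemma smooth_on_imp_differentiable_within:
  assumes "smooth_on A f" "x \<in> A"
  shows "f differentiable (at x within A)"
proof -
  obtain U F where U: "open U" "A \<subseteq> U" and C: "\<And>k. Ck_on k F U" and eq: "\<And>x. x \<in> A \<Longrightarrow> F x = f x"
    using assms(1) unfolding smooth_on_def by blast
  have "F differentiable (at x)"
    using C[of 1] U assms(2) by auto
  then have "F differentiable (at x within A)"
    by (rule differentiable_at_withinI)
  then show ?thesis
    by (rule differentiable_transform_within[of _ _ _ 1]) (use assms(2) eq in auto)
qed

lemma component_segment:
  fixes p q :: "'a::real_normed_vector"
  assumes "R \<in> components (M - D)" "p \<in> R" "closed_segment p q \<subseteq> M - D"
  shows "q \<in> R"
proof -
  have "closed_segment p q \<subseteq> R"
    by (rule components_maximal[OF assms(1) _ assms(3)]) (use assms(2) in \<open>auto simp: convex_connected\<close>)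
  then show ?thesis by auto
qed

lemma closed_segment_component:
  fixes w :: "real^'n"
  assumes "w \<in> closed_segment p q" "p $ i = c" "q $ i = c"
  shows "w $ i = c"
proof -
  obtain s where "w = (1 - s) *\<^sub>R p + s *\<^sub>R q" using assms(1) by (auto simp: closed_segment_def)
  then have "w $ i = (1 - s) * c + s * c" using assms(2,3) by simp
  then show ?thesis by (simp add: algebra_simps)
qed

lemma continuous_on_smooth_disk_embedding: "smooth_disk_embedding f \<Longrightarrow> continuous_on D2 f"
  by (auto simp: smooth_disk_embedding_def continuous_on_eq_continuous_within
      intro!: differentiable_imp_continuous_within smooth_on_imp_differentiable_within)

text \<open>The complement of the compact image is Borel, and its components are relatively closed
  in it.\<close>

lemma borel_subdivision:
  assumes "smooth_disk_embedding f" "subdivides_into (f ` D2) R\<^sub>1 R\<^sub>2"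
  shows "R\<^sub>1 \<in> sets borel" "R\<^sub>2 \<in> sets borel"
proof -
  have "compact (f ` D2)"
    using assms by (intro compact_continuous_image continuous_on_smooth_disk_embedding) auto
  then have MD: "M3 - f ` D2 \<in> sets borel"
    by (intro sets.Diff borel_closed compact_imp_closed) auto
  have "closedin (top_of_set (M3 - f ` D2)) R\<^sub>1" "closedin (top_of_set (M3 - f ` D2)) R\<^sub>2"
    using assms(2) by (auto simp: subdivides_into_def intro!: closedin_component)
  then show "R\<^sub>1 \<in> sets borel" "R\<^sub>2 \<in> sets borel"
    using MD by (auto simp: closedin_closed)
qed

text \<open>The exceptional lines are those that hit the disk inside a fixed box. Their parameter
  sets are projections of the disk along the two horizontal fields, and \<eta> bounds the areas of
  both because the disk area dominates a multiple of each projected area. Then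
  \<open>slicing\<close> applies.\<close>

lemma thin_disk_component_small:
  fixes f :: "real^2 \<Rightarrow> real^3" and N T \<epsilon> \<kappa> :: real and m :: nat
  defines "Q \<equiv> {p :: real^3. \<bar>p $ 1\<bar> \<le> 1/2 \<and> \<bar>p $ 2\<bar> \<le> 1/8 \<and> \<bar>p $ 3\<bar> \<le> 1/16}"
    and "\<eta> \<equiv> N / (T * ((1/4) ^ m)\<^sup>2)"
  assumes T: "T > 0" and \<epsilon>: "\<epsilon> > 0" and "N \<ge> 0"
    and f: "smooth_disk_embedding f" and sub: "subdivides_into (f ` D2) R\<^sub>1 R\<^sub>2"
    and area: "surface_area (squeezed_metric m T \<epsilon>) f D2 \<le> ennreal N"
    and \<eta>: "\<eta> < 1/128"
    and big: "ennreal \<kappa> \<le> emeasure lborel (R\<^sub>1 \<inter> Q)" "ennreal \<kappa> \<le> emeasure lborel (R\<^sub>2 \<inter> Q)"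
  shows "\<kappa> \<le> 6 * \<eta>"
proof -
  let ?g = "squeezed_metric m T \<epsilon>"
  define D where "D u = frechet_derivative f (at u within D2)" for u
  \<comment> \<open>A lower bound for \<open>T * w\<^sup>2\<close> on \<open>\<Omega>\<close>, where
    the squared norm is at most 3/4 and hence the weight w is at least
    \<open>(1/4) ^ m\<close>.\<close>
  define \<theta> where "\<theta> = T * ((1/4) ^ m)\<^sup>2"
  have \<theta>: "\<theta> > 0" using T by (simp add: \<theta>_def)
  \<comment> \<open>A convex box inside the ball that contains all segments considered in
    \<open>slicing\<close>.\<close>
  define \<Omega> :: "(real^3) set" where "\<Omega> = cbox (vector [-1/2, -1/2, -1/16]) (vector [1/2, 1/2, 1/16])"
  define K where "K = D2 \<inter> f -` \<Omega>"
  define \<phi>X :: "real^2 \<Rightarrow> real^2" where "\<phi>X u = vector [f u $ 2, f u $ 3]" for u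
  define \<phi>Y :: "real^2 \<Rightarrow> real^2" where "\<phi>Y u = vector [f u $ 1, f u $ 3 - f u $ 1 * f u $ 2]" for u
  have mem_\<Omega>: "p \<in> \<Omega> \<longleftrightarrow> \<bar>p $ 1\<bar> \<le> 1/2 \<and> \<bar>p $ 2\<bar> \<le> 1/2 \<and> \<bar>p $ 3\<bar> \<le> 1/16" for p
    unfolding \<Omega>_def mem_box_cart forall_3 by auto
  have norm_\<Omega>: "(norm p)\<^sup>2 \<le> 3/4" if "p \<in> \<Omega>" for p
  proof -
    have "(p $ 1)\<^sup>2 \<le> (1/2)\<^sup>2" "(p $ 2)\<^sup>2 \<le> (1/2)\<^sup>2" "(p $ 3)\<^sup>2 \<le> (1/16)\<^sup>2"
      using that unfolding mem_\<Omega> abs_le_square_iff[symmetric] by simp_all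
    then show ?thesis unfolding norm_sq_3 by (simp add: power2_eq_square)
  qed
  have \<Omega>_M3: "\<Omega> \<subseteq> M3"
  proof
    fix p assume "p \<in> \<Omega>"
    then have "(norm p)\<^sup>2 \<le> 1\<^sup>2" using norm_\<Omega>[of p] by simp
    then show "p \<in> M3" using power2_le_imp_le[of "norm p" 1] by simp
  qed
  have seg_\<Omega>: "closed_segment p q \<subseteq> \<Omega>" if "p \<in> \<Omega>" "q \<in> \<Omega>" for p q
    using that closed_segment_subset convex_box(1) unfolding \<Omega>_def by blast
  have fD: "(f has_derivative D u) (at u within D2)" if "u \<in> D2" for u
    using smooth_on_imp_differentiable_within[of D2 f u] f that
    unfolding D_def smooth_disk_embedding_def by (simp flip: frechet_derivative_works)
  have contf: "continuous_on D2 f" by (rule continuous_on_smooth_disk_embedding[OF f])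
  have "closed K"
    unfolding K_def \<Omega>_def by (intro continuous_closed_preimage contf) auto
  then have K: "compact K"
    unfolding K_def by (metis compact_Int_closed compact_cball inf.idem inf.left_commute inf_commute)
  have KD2: "K \<subseteq> D2" by (auto simp: K_def)
  have contK: "continuous_on K f" using contf KD2 continuous_on_subset by blast
  have coordD: "((\<lambda>u. f u $ i) has_derivative (\<lambda>v. D u v $ i)) (at u within K)" if "u \<in> K" for u i
    using has_derivative_subset[OF fD KD2] that KD2
    by (auto intro!: bounded_linear.has_derivative[OF bounded_linear_vec_nth])
  have dX: "(\<phi>X has_derivative (\<lambda>v. vector [D u v $ 2, D u v $ 3])) (at u within K)" if "u \<in> K" for u
    unfolding \<phi>X_def vector_2_eq_axis using that by (auto intro!: derivative_eq_intros coordD)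
  have dY: "(\<phi>Y has_derivative
      (\<lambda>v. vector [D u v $ 1, D u v $ 3 - (f u $ 1 * D u v $ 2 + D u v $ 1 * f u $ 2)])) (at u within K)"
    if "u \<in> K" for u
    unfolding \<phi>Y_def vector_2_eq_axis using that by (auto intro!: derivative_eq_intros coordD)
  \<comment> \<open>Both determinants are minors bounded in \<open>det_gram_heisenberg_ge\<close>.
    In the second one the term with \<open>f u $ 2\<close> is a multiple of the first row and
    cancels.\<close>
  have area_form: "\<theta> * \<bar>det (matrix (\<lambda>v. vector [D u v $ 2, D u v $ 3] :: real^2))\<bar> \<le>
        sqrt (det (pullback_metric ?g f D2 u))"
      "\<theta> * \<bar>det (matrix (\<lambda>v. vector [D u v $ 1, D u v $ 3 - (f u $ 1 * D u v $ 2 + D u v $ 1 * f u $ 2)]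
        :: real^2))\<bar> \<le> sqrt (det (pullback_metric ?g f D2 u))"
    if u: "u \<in> K" for u
  proof -
    define l where "l = (\<epsilon> + (1 - (norm (f u))\<^sup>2) ^ m) / T"
    have "(1/4) ^ m \<le> (1 - (norm (f u))\<^sup>2) ^ m"
      using norm_\<Omega>[of "f u"] u by (intro power_mono) (auto simp: K_def)
    then have "((1/4) ^ m)\<^sup>2 \<le> (\<epsilon> + (1 - (norm (f u))\<^sup>2) ^ m)\<^sup>2"
      using \<epsilon> by (intro power_mono) auto
    then have "\<theta> \<le> T * (\<epsilon> + (1 - (norm (f u))\<^sup>2) ^ m)\<^sup>2"
      unfolding \<theta>_def using T by (intro mult_left_mono) auto
    also have "\<dots> = l\<^sup>2 * T ^ 3"
      using T by (simp add: l_def power_divide power2_eq_square power3_eq_cube)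
    finally have \<theta>l: "\<theta> \<le> l\<^sup>2 * T ^ 3" .
    have pb: "pullback_metric ?g f D2 u =
        transpose (matrix (D u)) ** (l\<^sup>2 *\<^sub>R heisenberg_form (T ^ 3) (f u)) ** matrix (D u)"
      by (simp add: pullback_metric_def squeezed_metric_def Let_def D_def l_def)
    have T3: "0 \<le> T ^ 3" using T by simp
    show "\<theta> * \<bar>det (matrix (\<lambda>v. vector [D u v $ 2, D u v $ 3] :: real^2))\<bar> \<le>
        sqrt (det (pullback_metric ?g f D2 u))"
      unfolding pb
      by (rule order_trans[OF mult_right_mono[OF \<theta>l] order_trans[OF eq_refl det_gram_heisenberg_ge(1)[OF T3]]])
         (simp_all add: det_2 matrix_def algebra_simps)
    show "\<theta> * \<bar>det (matrix (\<lambda>v. vector [D u v $ 1, D u v $ 3 - (f u $ 1 * D u v $ 2 + D u v $ 1 * f u $ 2)]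
        :: real^2))\<bar> \<le> sqrt (det (pullback_metric ?g f D2 u))"
      unfolding pb
      by (rule order_trans[OF mult_right_mono[OF \<theta>l] order_trans[OF eq_refl det_gram_heisenberg_ge(2)[OF T3]]])
         (simp_all add: det_2 matrix_def algebra_simps)
  qed
  have int_le: "(\<integral>\<^sup>+u\<in>K. ennreal (j u) \<partial>lborel) \<le> ennreal N"
    if "\<And>u. u \<in> K \<Longrightarrow> j u \<le> sqrt (det (pullback_metric ?g f D2 u))" for j
  proof -
    have "(\<integral>\<^sup>+u\<in>K. ennreal (j u) \<partial>lborel) \<le> surface_area ?g f D2"
      unfolding surface_area_def using that KD2
      by (intro nn_integral_mono) (auto simp: indicator_def intro!: ennreal_leI)
    with area show ?thesis by order
  qed
  have cX: "compact (\<phi>X ` K)" and cY: "compact (\<phi>Y ` K)"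
    unfolding \<phi>X_def \<phi>Y_def by (intro compact_continuous_image K continuous_intros contK)+
  have eX: "emeasure lborel (\<phi>X ` K) \<le> ennreal \<eta>"
    unfolding \<eta>_def \<theta>_def[symmetric]
    by (rule area_image_le[OF lmeasurable_compact[OF K] dX int_le \<theta> \<open>N \<ge> 0\<close> borel_compact[OF cX]])
       (use area_form in auto)
  have eY: "emeasure lborel (\<phi>Y ` K) \<le> ennreal \<eta>"
    unfolding \<eta>_def \<theta>_def[symmetric]
    by (rule area_image_le[OF lmeasurable_compact[OF K] dY int_le \<theta> \<open>N \<ge> 0\<close> borel_compact[OF cY]])
       (use area_form in auto)
  have comps: "components (M3 - f ` D2) = {R\<^sub>1, R\<^sub>2}" "R\<^sub>1 \<noteq> R\<^sub>2"
    using sub by (auto simp: subdivides_into_def)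
  have cover: "R\<^sub>1 \<union> R\<^sub>2 = M3 - f ` D2"
    using Union_components[of "M3 - f ` D2"] unfolding comps by simp
  have disj: "R\<^sub>1 \<inter> R\<^sub>2 = {}"
    using components_nonoverlap[of R\<^sub>1 "M3 - f ` D2" R\<^sub>2] comps by simp
  show ?thesis
  proof (rule slicing[of R\<^sub>1 R\<^sub>2 "\<phi>X ` K" "\<phi>Y ` K"])
    show "0 \<le> \<eta>" using \<open>N \<ge> 0\<close> T by (simp add: \<eta>_def)
    show "ennreal \<kappa> \<le> emeasure lborel (R\<^sub>1 \<inter> {p. \<bar>p $ 1\<bar> \<le> 1/2 \<and> \<bar>p $ 2\<bar> \<le> 1/8 \<and> \<bar>p $ 3\<bar> \<le> 1/16})"
      "ennreal \<kappa> \<le> emeasure lborel (R\<^sub>2 \<inter> {p. \<bar>p $ 1\<bar> \<le> 1/2 \<and> \<bar>p $ 2\<bar> \<le> 1/8 \<and> \<bar>p $ 3\<bar> \<le> 1/16})"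
      using big by (simp_all add: Q_def)
  next
    fix y z :: real
    assume yz: "\<bar>y\<bar> \<le> 1/2" "\<bar>z\<bar> \<le> 1/16" "vector [y, z] \<notin> \<phi>X ` K"
    let ?p = "vector [0, y, z] :: real^3"
    have "?p \<in> \<Omega>" using yz by (simp add: mem_\<Omega>)
    moreover have "?p \<notin> f ` D2"
    proof
      assume "?p \<in> f ` D2"
      then obtain u where u: "u \<in> D2" "f u = ?p" by auto
      then have "u \<in> K" "\<phi>X u = vector [y, z]" using \<open>?p \<in> \<Omega>\<close> by (auto simp: K_def \<phi>X_def)
      then show False using yz by (metis imageI)
    qed
    ultimately show "?p \<in> R\<^sub>1 \<union> R\<^sub>2" using \<Omega>_M3 unfolding cover by blast
  next
    fix R and x x' y z :: real
    assume R: "R \<in> {R\<^sub>1, R\<^sub>2}" and xyz: "\<bar>x\<bar> \<le> 1/2" "\<bar>x'\<bar> \<le> 1/2" "\<bar>y\<bar> \<le> 1/2" "\<bar>z\<bar> \<le> 1/16"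
      and nB: "vector [y, z] \<notin> \<phi>X ` K" and p: "vector [x, y, z] \<in> R"
    let ?p = "vector [x, y, z] :: real^3" and ?q = "vector [x', y, z] :: real^3"
    have seg: "closed_segment ?p ?q \<subseteq> \<Omega>" using xyz by (intro seg_\<Omega>) (simp_all add: mem_\<Omega>)
    have "w \<notin> f ` D2" if w: "w \<in> closed_segment ?p ?q" for w
    proof
      assume "w \<in> f ` D2"
      then obtain u where u: "u \<in> D2" "f u = w" by auto
      \<comment> \<open>The invariants (y, z) are constant along the X-segment, so a hit of the disk
        would put them into the projection of \<open>K\<close>.\<close>
      have "w $ 2 = y" "w $ 3 = z" using closed_segment_component[OF w] by auto
      then have "u \<in> K" "\<phi>X u = vector [y, z]" using u w seg by (auto simp: K_def \<phi>X_def)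
      then show False using nB by (metis imageI)
    qed
    then have "closed_segment ?p ?q \<subseteq> M3 - f ` D2" using seg \<Omega>_M3 by blast
    with p R show "?q \<in> R" using component_segment[of R M3 "f ` D2"] comps by blast
  next
    fix x y z y' z' :: real
    assume xyz: "\<bar>x\<bar> \<le> 1/2" "\<bar>y\<bar> \<le> 1/2" "\<bar>z\<bar> \<le> 1/16" "\<bar>y'\<bar> \<le> 1/2" "\<bar>z'\<bar> \<le> 1/16"
      and eq: "z - x * y = z' - x * y'"
      and p: "vector [x, y, z] \<in> R\<^sub>1" and q: "vector [x, y', z'] \<in> R\<^sub>2"
    let ?p = "vector [x, y, z] :: real^3" and ?q = "vector [x, y', z'] :: real^3"
    have seg: "closed_segment ?p ?q \<subseteq> \<Omega>" using xyz by (intro seg_\<Omega>) (simp_all add: mem_\<Omega>)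
    show "vector [x, z - x * y] \<in> \<phi>Y ` K"
    proof (rule ccontr)
      assume nB: "vector [x, z - x * y] \<notin> \<phi>Y ` K"
      have "w \<notin> f ` D2" if w: "w \<in> closed_segment ?p ?q" for w
      proof
        assume "w \<in> f ` D2"
        then obtain u where u: "u \<in> D2" "f u = w" by auto
        have w1: "w $ 1 = x" using closed_segment_component[OF w] by auto
        \<comment> \<open>As x is constant on the segment, z - x y is affine along it with equal end
          values, hence constant: the segment is part of a Y-line.\<close>
        obtain s where "w = (1 - s) *\<^sub>R ?p + s *\<^sub>R ?q" using w by (auto simp: closed_segment_def)
        then have w23: "w $ 3 = (1 - s) * z + s * z'" "w $ 2 = (1 - s) * y + s * y'" by simp_all
        have "w $ 3 - x * w $ 2 = (1 - s) * (z - x * y) + s * (z' - x * y')"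
          unfolding w23 by (simp add: algebra_simps)
        then have "w $ 3 - w $ 1 * w $ 2 = z - x * y" using w1 by (simp add: eq[symmetric] algebra_simps)
        with w1 have "u \<in> K" "\<phi>Y u = vector [x, z - x * y]" using u w seg by (auto simp: K_def \<phi>Y_def)
        then show False using nB by (metis imageI)
      qed
      then have "closed_segment ?p ?q \<subseteq> M3 - f ` D2" using seg \<Omega>_M3 by blast
      with p have "?q \<in> R\<^sub>1" using component_segment[of R\<^sub>1 M3 "f ` D2"] comps by blast
      with q disj show False by blast
    qed
  qed (use borel_subdivision[OF f sub] cX cY eX eY \<eta> in \<open>auto intro: borel_compact\<close>)
qed

section \<open>Volume\<close>

lemma riemannian_volume_squeezed_metric:
  assumes "T > 0" "\<epsilon> > 0" "R \<subseteq> M3"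
  shows "riemannian_volume (squeezed_metric m T \<epsilon>) R =
    (\<integral>\<^sup>+x\<in>R. ennreal ((\<epsilon> + (1 - (norm x)\<^sup>2) ^ m) ^ 3) \<partial>lborel)"
  unfolding riemannian_volume_def
  using assms sqrt_det_squeezed_metric[OF assms(1,2)]
  by (intro nn_integral_cong) (auto simp: indicator_def)

lemma emeasure_M3_le: "emeasure lborel M3 \<le> 8"
proof -
  have "M3 \<subseteq> cbox (vector [-1, -1, -1]) (vector [1, 1, 1])"
  proof
    fix x :: "real^3" assume "x \<in> M3"
    then have "\<bar>x $ i\<bar> \<le> 1" for i using component_le_norm_cart[of x i] by simp
    then show "x \<in> cbox (vector [-1, -1, -1]) (vector [1, 1, 1])"
      by (simp add: mem_box_cart forall_3 abs_le_iff minus_le_iff)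
  qed
  then have "emeasure lborel M3 \<le> emeasure lborel (cbox (vector [-1, -1, -1]) (vector [1, 1, 1]) :: (real^3) set)"
    by (intro emeasure_mono) auto
  also have "\<dots> = 8"
    by (simp add: emeasure_lborel_cbox_eq Basis_vec_3 inner_axis axis_neq)
  finally show ?thesis .
qed

lemma volume_squeezed_metric_le:
  assumes "T > 0" "\<epsilon> > 0" "\<epsilon> \<le> 1/16"
  shows "riemannian_volume (squeezed_metric m T \<epsilon>) M3 \<le> 10"
proof -
  \<comment> \<open>The cube of 17/16 is below 5/4, and 5/4 times the bound 8 for the Euclidean
    volume of the ball is 10.\<close>
  have "(\<epsilon> + (1 - (norm x)\<^sup>2) ^ m) ^ 3 \<le> 5/4" if "x \<in> M3" for x
  proof -
    have "(norm x)\<^sup>2 \<le> 1" using that by (simp add: abs_square_le_1)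
    then have "(\<epsilon> + (1 - (norm x)\<^sup>2) ^ m) ^ 3 \<le> (1/16 + 1) ^ 3"
      using assms by (intro power_mono add_mono power_le_one) auto
    then show ?thesis by (simp add: power3_eq_cube)
  qed
  then have "riemannian_volume (squeezed_metric m T \<epsilon>) M3 \<le> (\<integral>\<^sup>+x\<in>M3. ennreal (5/4) \<partial>lborel)"
    unfolding riemannian_volume_squeezed_metric[OF assms(1,2) order_refl]
    by (intro nn_integral_mono) (auto simp: indicator_def intro!: ennreal_leI)
  also have "\<dots> = ennreal (5/4) * emeasure lborel M3"
    by (simp add: nn_integral_cmult_indicator)
  also have "\<dots> \<le> ennreal (5/4) * ennreal 8"
    using emeasure_M3_le by (intro mult_left_mono) auto
  also have "\<dots> = 10"
    by (subst ennreal_mult[symmetric]) auto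
  finally show ?thesis .
qed

text \<open>\<open>W\<close> bounds the total volume from below, using only the ball of radius 1/32.
  The ball of radius 1/16 lies in \<open>Q\<close>, and by \<open>conc\<close> at most
  \<open>c / 2 * W\<close> of the volume lies outside it. A region of volume above
  \<open>c * W\<close> thus keeps at least \<open>c / 2 * W\<close> inside \<open>Q\<close>, where
  the density is at most 2.\<close>

lemma core_volume_ge:
  fixes c T \<epsilon> :: real and R :: "(real^3) set" and m :: nat
  defines "Q \<equiv> {p :: real^3. \<bar>p $ 1\<bar> \<le> 1/2 \<and> \<bar>p $ 2\<bar> \<le> 1/8 \<and> \<bar>p $ 3\<bar> \<le> 1/16}"
    and "W \<equiv> ((1 - (1/32)\<^sup>2) ^ m) ^ 3 * measure lborel (cball 0 (1/32) :: (real^3) set)"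
  assumes T: "T > 0" and \<epsilon>: "\<epsilon> > 0" "\<epsilon> \<le> 1/16" "\<epsilon> \<le> (1 - (1/16)\<^sup>2) ^ m" and c: "c > 0"
    and conc: "64 * ((1 - (1/16)\<^sup>2) ^ m) ^ 3 \<le> c / 2 * W"
    and R: "R \<in> sets borel" "R \<subseteq> M3"
    and vol: "riemannian_volume (squeezed_metric m T \<epsilon>) R > ennreal c * riemannian_volume (squeezed_metric m T \<epsilon>) M3"
  shows "ennreal (c / 4 * W) \<le> emeasure lborel (R \<inter> Q)"
proof -
  let ?vol = "riemannian_volume (squeezed_metric m T \<epsilon>)"
  define s where "s = (1 - (1/16)\<^sup>2 :: real) ^ m"
  have s: "0 < s" "s \<le> 1" by (auto simp: s_def power2_eq_square intro!: power_le_one)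
  have W: "0 \<le> W" unfolding W_def by (intro mult_nonneg_nonneg zero_le_power) (auto simp: power2_eq_square)
  have [measurable]: "Q \<in> sets borel" unfolding Q_def by measurable
  have [measurable]: "R \<in> sets borel" by (rule R)
  have [measurable]: "M3 \<in> sets borel" by simp
  \<comment> \<open>Outside the ball of radius 1/16 both \<epsilon> and the power are at most
    \<open>s\<close>, so the density is at most the cube of 2 s. Over a ball of Euclidean volume at
    most 8 this integrates to at most \<open>64 * s ^ 3\<close>.\<close>
  have dens: "ennreal ((\<epsilon> + (1 - (norm x)\<^sup>2) ^ m) ^ 3) * indicator R x \<le>
      2 * indicator (R \<inter> Q) x + ennreal (8 * s ^ 3) * indicator M3 x" for x
  proof (cases "x \<in> R")
    case xR: True
    then have xM: "x \<in> M3" using R by auto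
    then have nx: "(norm x)\<^sup>2 \<le> 1" by (simp add: abs_square_le_1)
    show ?thesis
    proof (cases "norm x \<le> 1/16")
      case True
      have "\<bar>x $ i\<bar> \<le> 1/16" for i using component_le_norm_cart[of x i] True by linarith
      from this[of 1] this[of 2] this[of 3] have "x \<in> Q" by (simp add: Q_def)
      have "(\<epsilon> + (1 - (norm x)\<^sup>2) ^ m) ^ 3 \<le> (1/16 + 1) ^ 3"
        using \<epsilon> nx by (intro power_mono add_mono power_le_one) auto
      then have "(\<epsilon> + (1 - (norm x)\<^sup>2) ^ m) ^ 3 \<le> 2" by (simp add: power3_eq_cube)
      then have "ennreal ((\<epsilon> + (1 - (norm x)\<^sup>2) ^ m) ^ 3) \<le> ennreal 2" by (rule ennreal_leI)
      then show ?thesis using xR \<open>x \<in> Q\<close> by (simp add: add_increasing2)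
    next
      case False
      then have "(1/16)\<^sup>2 \<le> (norm x)\<^sup>2" by (intro power_mono) auto
      then have "(1 - (norm x)\<^sup>2) ^ m \<le> s"
        unfolding s_def using nx by (intro power_mono) auto
      then have "(\<epsilon> + (1 - (norm x)\<^sup>2) ^ m) ^ 3 \<le> (s + s) ^ 3"
        using \<epsilon> nx by (intro power_mono add_mono) (auto simp: s_def)
      also have "\<dots> = 8 * s ^ 3" by (simp add: power3_eq_cube)
      finally have "ennreal ((\<epsilon> + (1 - (norm x)\<^sup>2) ^ m) ^ 3) \<le> ennreal (8 * s ^ 3)" by (rule ennreal_leI)
      then show ?thesis using xR xM by (simp add: add_increasing)
    qed
  qed simp
  have "?vol R \<le> (\<integral>\<^sup>+x. 2 * indicator (R \<inter> Q) x + ennreal (8 * s ^ 3) * indicator M3 x \<partial>lborel)"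
    unfolding riemannian_volume_squeezed_metric[OF T \<epsilon>(1) R(2)] by (intro nn_integral_mono dens)
  also have "\<dots> = 2 * emeasure lborel (R \<inter> Q) + ennreal (8 * s ^ 3) * emeasure lborel M3"
    by (subst nn_integral_add, measurable) (simp add: nn_integral_cmult_indicator)
  also have "\<dots> \<le> 2 * emeasure lborel (R \<inter> Q) + ennreal (8 * s ^ 3) * ennreal 8"
    using emeasure_M3_le by (intro add_mono mult_left_mono) auto
  also have "ennreal (8 * s ^ 3) * ennreal 8 = ennreal (64 * s ^ 3)"
    using s by (subst ennreal_mult[symmetric]) auto
  also have "2 * emeasure lborel (R \<inter> Q) + \<dots> \<le> 2 * emeasure lborel (R \<inter> Q) + ennreal (c / 2 * W)"
    using conc by (intro add_left_mono ennreal_leI) (simp add: s_def)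
  finally have upper: "?vol R \<le> 2 * emeasure lborel (R \<inter> Q) + ennreal (c / 2 * W)" .
  have "ennreal W = (\<integral>\<^sup>+x\<in>cball 0 (1/32) :: (real^3) set. ennreal (((1 - (1/32)\<^sup>2) ^ m) ^ 3) \<partial>lborel)"
  proof -
    have "emeasure lborel (cball 0 (1/32) :: (real^3) set) = ennreal (measure lborel (cball 0 (1/32) :: (real^3) set))"
      using emeasure_bounded_finite[of "cball (0 :: real^3) (1/32)"]
      by (intro emeasure_eq_ennreal_measure) auto
    then show ?thesis
      unfolding W_def by (subst ennreal_mult) (auto simp: nn_integral_cmult_indicator power2_eq_square)
  qed
  also have "\<dots> \<le> ?vol M3"
    unfolding riemannian_volume_squeezed_metric[OF T \<epsilon>(1) order_refl]
  proof (intro nn_integral_mono)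
    fix x :: "real^3"
    show "ennreal (((1 - (1/32)\<^sup>2) ^ m) ^ 3) * indicator (cball 0 (1/32)) x \<le>
        ennreal ((\<epsilon> + (1 - (norm x)\<^sup>2) ^ m) ^ 3) * indicator M3 x"
    proof (cases "norm x \<le> 1/32")
      case True
      then have "(norm x)\<^sup>2 \<le> (1/32)\<^sup>2" by (intro power_mono) auto
      then have "(1 - (1/32)\<^sup>2) ^ m \<le> (1 - (norm x)\<^sup>2) ^ m"
        by (intro power_mono) (auto simp: power2_eq_square)
      then have "((1 - (1/32)\<^sup>2) ^ m) ^ 3 \<le> (\<epsilon> + (1 - (norm x)\<^sup>2) ^ m) ^ 3"
        using \<epsilon> by (intro power_mono) (auto simp: power2_eq_square)
      then show ?thesis using True by (simp add: ennreal_leI)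
    qed simp
  qed
  finally have "ennreal c * ennreal W \<le> ennreal c * ?vol M3" by (rule mult_left_mono) simp
  with vol upper have ineq: "ennreal (c * W) \<le> 2 * emeasure lborel (R \<inter> Q) + ennreal (c / 2 * W)"
    using c W by (simp add: ennreal_mult)
  have "emeasure lborel (R \<inter> Q) \<le> emeasure lborel M3" using R by (intro emeasure_mono) auto
  also have "\<dots> < top" using emeasure_M3_le by (simp add: order_le_less_trans)
  finally have e: "emeasure lborel (R \<inter> Q) = ennreal (measure lborel (R \<inter> Q))"
    by (intro emeasure_eq_ennreal_measure) simp
  have "ennreal (c * W) \<le> ennreal (2 * measure lborel (R \<inter> Q) + c / 2 * W)"
    using ineq c W unfolding e by (simp add: ennreal_mult)
  then have "c * W \<le> 2 * measure lborel (R \<inter> Q) + c / 2 * W"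
    using c W by (subst (asm) ennreal_le_iff) auto
  then show ?thesis unfolding e by (intro ennreal_leI) (simp add: algebra_simps)
qed

theorem proposition1p2:
  fixes N c :: real
  assumes "N > 0" and "0 < c" and "c < 1"
  shows "\<exists>g. riemannian_metric g \<and>
           riemannian_diameter g \<le> 10 \<and>
           riemannian_volume g M3 \<le> 10 \<and>
           boundary_area g \<le> 10 \<and>
           (\<forall>f R\<^sub>1 R\<^sub>2.
              smooth_disk_embedding f \<and> subdivides_into (f ` D2) R\<^sub>1 R\<^sub>2 \<and>
              riemannian_volume g R\<^sub>1 > ennreal c * riemannian_volume g M3 \<and>
              riemannian_volume g R\<^sub>2 > ennreal c * riemannian_volume g M3 \<longrightarrow>
              surface_area g f D2 > ennreal N)"
proof -
  \<comment> \<open>The parameters are fixed in the order m, T, \<epsilon>: \<open>m\<close>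
    concentrates the volume, \<open>T\<close> makes the projections of the disk small, and
    \<epsilon> compensates the stretching on the boundary.\<close>
  define v where "v = measure lborel (cball 0 (1/32) :: (real^3) set)"
  have v: "v > 0" unfolding v_def using content_cball_pos[of "1/32" "0 :: real^3"] by simp
  define s\<^sub>1 s\<^sub>2 :: real where "s\<^sub>1 = 1 - (1/16)\<^sup>2" and "s\<^sub>2 = 1 - (1/32)\<^sup>2"
  have s: "0 < s\<^sub>1" "s\<^sub>1 < s\<^sub>2" by (auto simp: s\<^sub>1_def s\<^sub>2_def power2_eq_square)
  \<comment> \<open>The constant 128 combines the 64 of the tail bound with the 2 of c / 2.\<close>
  obtain n where n: "(s\<^sub>1 / s\<^sub>2) ^ n < c * v / 128"
    using real_arch_pow_inv[of "c * v / 128" "s\<^sub>1 / s\<^sub>2"] s v assms by auto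
  \<comment> \<open>The successor makes \<open>m\<close> positive, so that the weight on the sphere
    is \<epsilon>.\<close>
  define m where "m = Suc n"
  define W where "W = (s\<^sub>2 ^ m) ^ 3 * v"
  have W: "W > 0" using v s by (simp add: W_def)
  have conc: "64 * (s\<^sub>1 ^ m) ^ 3 \<le> c / 2 * W"
  proof -
    have q: "0 \<le> s\<^sub>1 / s\<^sub>2" "s\<^sub>1 / s\<^sub>2 \<le> 1" using s by auto
    have "(s\<^sub>1 ^ m) ^ 3 = (s\<^sub>1 / s\<^sub>2) ^ (m * 3) * (s\<^sub>2 ^ m) ^ 3"
      using s by (simp add: power_mult power_divide)
    also have "\<dots> \<le> (c * v / 128) * (s\<^sub>2 ^ m) ^ 3"
    proof (rule mult_right_mono)
      have "(s\<^sub>1 / s\<^sub>2) ^ (m * 3) \<le> (s\<^sub>1 / s\<^sub>2) ^ n"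
        using q by (intro power_decreasing) (auto simp: m_def)
      then show "(s\<^sub>1 / s\<^sub>2) ^ (m * 3) \<le> c * v / 128" using n by linarith
    qed (use s in auto)
    finally show ?thesis by (simp add: W_def mult_ac)
  qed
  \<comment> \<open>The Euclidean volume that \<open>core_volume_ge\<close> guarantees near the
    centre for each region.\<close>
  define \<kappa> where "\<kappa> = c / 4 * W"
  have \<kappa>: "\<kappa> > 0" using W assms by (simp add: \<kappa>_def)
  define \<theta> :: real where "\<theta> = ((1/4) ^ m)\<^sup>2"
  have \<theta>: "\<theta> > 0" by (simp add: \<theta>_def)
  \<comment> \<open>The summand 4 serves the diameter. In addition \<open>N / (T * \<theta>)\<close>
    falls below \<open>1 / (128 + 7 / \<kappa>)\<close>, hence below both 1/128 and \<kappa> / 7,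
    and six sevenths of \<kappa> is less than \<kappa>.\<close>
  define T where "T = 4 + (128 + 7 / \<kappa>) * N / \<theta>"
  have T: "T \<ge> 4" using assms \<kappa> \<theta> by (simp add: T_def)
  have "N * (128 + 7 / \<kappa>) < T * \<theta>"
    using \<theta> unfolding T_def by (simp add: field_simps)
  then have \<eta>: "N / (T * \<theta>) < 1 / (128 + 7 / \<kappa>)"
    using \<theta> T \<kappa> by (simp add: pos_divide_less_eq pos_less_divide_eq add_pos_pos)
  have \<eta>1: "N / (T * \<theta>) < 1/128"
  proof -
    have "1 / (128 + 7 / \<kappa>) \<le> 1 / 128" using \<kappa> by (intro divide_left_mono mult_pos_pos add_pos_pos) auto
    with \<eta> show ?thesis by linarith
  qed
  have \<eta>2: "6 * (N / (T * \<theta>)) < \<kappa>"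
  proof -
    have "1 / (128 + 7 / \<kappa>) \<le> 1 / (7 / \<kappa>)" using \<kappa> by (intro divide_left_mono mult_pos_pos add_pos_pos) auto
    with \<eta> \<kappa> show ?thesis by simp
  qed
  define J where "J = enn2real (\<integral>\<^sup>+(u :: real^2). ennreal (4 / (1 + (norm u)\<^sup>2)\<^sup>2) \<partial>lborel)"
  have J: "(\<integral>\<^sup>+(u :: real^2). ennreal (4 / (1 + (norm u)\<^sup>2)\<^sup>2) \<partial>lborel) = ennreal J" "J \<ge> 0"
    using nn_integral_stereo_density_finite by (auto simp: J_def)
  \<comment> \<open>With \<open>L\<close> the diameter condition reads
    \<open>\<epsilon>\<^sup>2 * L * 4 \<le> 1\<close>, and the boundary area is at most
    \<open>\<epsilon>\<^sup>2 * L * J\<close>.\<close>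
  define L where "L = (1 + 2 * (T ^ 3)\<^sup>2) / T\<^sup>2"
  have L: "L \<ge> 0" by (simp add: L_def)
  \<comment> \<open>The bound 1/16 serves the volume, the second term the decay of the density away
    from the centre, and the third gives \<open>\<epsilon>\<^sup>2 * (L * (4 + J)) \<le> 1\<close>,
    since \<open>\<epsilon>\<^sup>2 \<le> \<epsilon>\<close>.\<close>
  define \<epsilon> where "\<epsilon> = min (min (1/16) (s\<^sub>1 ^ m)) (1 / (1 + L * (4 + J)))"
  have LJ: "0 < 1 + L * (4 + J)" using L J by (intro add_pos_nonneg) auto
  have \<epsilon>: "0 < \<epsilon>" "\<epsilon> \<le> 1/16" "\<epsilon> \<le> s\<^sub>1 ^ m" "\<epsilon> \<le> 1 / (1 + L * (4 + J))"
    using s LJ by (auto simp: \<epsilon>_def)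
  have "\<epsilon> * (1 + L * (4 + J)) \<le> 1" using \<epsilon>(4) LJ by (simp add: pos_le_divide_eq)
  moreover have "\<epsilon>\<^sup>2 \<le> \<epsilon>" using \<epsilon> by (simp add: power2_eq_square mult_left_le)
  then have "\<epsilon>\<^sup>2 * (L * (4 + J)) \<le> \<epsilon> * (L * (4 + J))" using L J by (intro mult_right_mono) auto
  ultimately have \<epsilon>L: "\<epsilon>\<^sup>2 * L * 4 + \<epsilon>\<^sup>2 * L * J \<le> 1" using \<epsilon> by (simp add: algebra_simps)
  have "0 \<le> \<epsilon>\<^sup>2 * L * 4" "0 \<le> \<epsilon>\<^sup>2 * L * J" using L J by auto
  with \<epsilon>L have \<epsilon>L': "\<epsilon>\<^sup>2 * L * 4 \<le> 1" "\<epsilon>\<^sup>2 * L * J \<le> 1" by linarith+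
  have TL: "(\<epsilon> / T)\<^sup>2 * (1 + 2 * (T ^ 3)\<^sup>2) = \<epsilon>\<^sup>2 * L" by (simp add: L_def power_divide)
  let ?g = "squeezed_metric m T \<epsilon>"
  have T0: "T > 0" using T by simp
  show ?thesis
  proof (intro exI[of _ ?g] conjI allI impI)
    show "riemannian_metric ?g" using T0 \<epsilon>(1) by (rule riemannian_metric_squeezed_metric)
    have "riemannian_diameter ?g \<le> 4"
    proof (rule diameter_squeezed_metric_le)
      show "(\<epsilon> / T)\<^sup>2 * (1 + 2 * (T ^ 3)\<^sup>2) * 4 \<le> 1" unfolding TL by (rule \<epsilon>L'(1))
    qed (use T0 T \<epsilon> in \<open>auto simp: m_def\<close>)
    also have "(4::ennreal) \<le> 10" by simp
    finally show "riemannian_diameter ?g \<le> 10" .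
    show "riemannian_volume ?g M3 \<le> 10" using T0 \<epsilon>(1,2) by (rule volume_squeezed_metric_le)
    have "boundary_area ?g \<le> ennreal (\<epsilon>\<^sup>2 * L) * ennreal J"
      using boundary_area_squeezed_metric_le[of m T \<epsilon>] unfolding J TL by (simp add: m_def)
    also have "\<dots> = ennreal (\<epsilon>\<^sup>2 * L * J)" using L J by (simp add: ennreal_mult)
    also have "\<dots> \<le> ennreal 10" using \<epsilon>L'(2) by (intro ennreal_leI) simp
    finally show "boundary_area ?g \<le> 10" by simp
  next
    fix f R\<^sub>1 R\<^sub>2
    assume A: "smooth_disk_embedding f \<and> subdivides_into (f ` D2) R\<^sub>1 R\<^sub>2 \<and>
              riemannian_volume ?g R\<^sub>1 > ennreal c * riemannian_volume ?g M3 \<and>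
              riemannian_volume ?g R\<^sub>2 > ennreal c * riemannian_volume ?g M3"
    then have f: "smooth_disk_embedding f" and sub: "subdivides_into (f ` D2) R\<^sub>1 R\<^sub>2" by auto
    have "R\<^sub>1 \<in> components (M3 - f ` D2)" "R\<^sub>2 \<in> components (M3 - f ` D2)"
      using sub by (auto simp: subdivides_into_def)
    then have R: "R\<^sub>1 \<subseteq> M3" "R\<^sub>2 \<subseteq> M3"
      using in_components_subset by fast+
    have big: "ennreal \<kappa> \<le> emeasure lborel (R \<inter> {p. \<bar>p $ 1\<bar> \<le> 1/2 \<and> \<bar>p $ 2\<bar> \<le> 1/8 \<and> \<bar>p $ 3\<bar> \<le> 1/16})"
      if "R \<in> {R\<^sub>1, R\<^sub>2}" for R
      unfolding \<kappa>_def W_def s\<^sub>2_def v_def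
    proof (rule core_volume_ge[OF T0 \<epsilon>(1,2)])
      show "R \<in> sets borel" using that borel_subdivision[OF f sub] by auto
    qed (use that A R \<epsilon> conc assms in \<open>auto simp: W_def s\<^sub>1_def s\<^sub>2_def v_def\<close>)
    show "ennreal N < surface_area ?g f D2"
    \<comment> \<open>A disk of area at most \<open>N\<close> would force \<kappa> to be at most six
      times the projection bound, which the choice of \<open>T\<close> excludes.\<close>
    proof (rule ccontr)
      assume "\<not> ?thesis"
      then have area: "surface_area ?g f D2 \<le> ennreal N" by simp
      have "\<kappa> \<le> 6 * (N / (T * ((1/4) ^ m)\<^sup>2))"
      proof (rule thin_disk_component_small[OF T0 \<epsilon>(1) _ f sub area])
        show "N / (T * ((1/4) ^ m)\<^sup>2) < 1/128" using \<eta>1 by (simp add: \<theta>_def)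
      qed (use assms big in auto)
      then show False using \<eta>2 by (simp add: \<theta>_def)
    qed
  qed
qed

end
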